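(* Let $\mu\in M(\mathbb{R}^{2d})$ and $S\in\mathcal{S}^1$. Then $$\mathcal{F}_W(\mu\star S)=\mathcal{F}_\sigma(\mu)\,\mathcal{F}_W(S).$$
   Context: For $z=(x,\omega)\in\mathbb{R}^{2d}$, $\pi(z)\psi(t)=e^{2\pi i\omega\cdot t}\psi(t-x)$ on $L^2(\mathbb{R}^d)$. $\mathcal{S}^1$ is the space of trace-class operators on $L^2(\mathbb{R}^d)$ and $M(\mathbb{R}^{2d})$ the space of bounded complex measures. The operator $\mu\star S\in\mathcal{S}^1$ is given weakly by $\langle(\mu\star S)\psi,\phi\rangle=\int_{\mathbb{R}^{2d}}\langle\pi(z)S\pi(z)^*\psi,\phi\rangle\,d\mu(z)$. The Fourier–Wigner transform is $\mathcal{F}_W(S)(z)=e^{-\pi i x\cdot\omega}\operatorname{tr}(\pi(-z)S)$ for $z=(x,\omega)$. The symplectic Fourier transform of a measure is $\mathcal{F}_\sigma(\mu)(z)=\int_{\mathbb{R}^{2d}}e^{-2\pi i\sigma(z,z')}\,d\mu(z')$, where $\sigma(z,z')=\omega\cdot x'-\omega'\cdot x$ for $z=(x,\omega)$, $z'=(x',\omega')$. *)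

theory Defs
  imports "HOL-Analysis.Analysis"
begin

section \<open>The Hilbert space of square-integrable functions\<close>

text \<open>
  Every Lebesgue-measurable function agrees almost everywhere with a Borel-measurable one, so using
  \<^term>\<open>lborel\<close> instead of \<^term>\<open>lebesgue\<close> gives the same classes of functions.
\<close>

definition square_integrable :: "('a::euclidean_space \<Rightarrow> complex) \<Rightarrow> bool" where
  "square_integrable f \<longleftrightarrow>
     f \<in> borel_measurable lborel \<and> integrable lborel (\<lambda>t. (cmod (f t))\<^sup>2)"

definition l2_rel :: "('a::euclidean_space \<Rightarrow> complex) \<Rightarrow> ('a \<Rightarrow> complex) \<Rightarrow> bool" where
  "l2_rel f g \<longleftrightarrow> square_integrable f \<and> square_integrable g \<and> (AE t in lborel. f t = g t)"

lemma square_integrable_measurable [measurable_dest]: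
  "square_integrable f \<Longrightarrow> f \<in> borel_measurable borel"
  by (simp add: square_integrable_def)

lemma square_integrable_zero: "square_integrable (\<lambda>t. 0)"
  by (simp add: square_integrable_def)

lemma square_integrable_add:
  assumes f: "square_integrable f" and g: "square_integrable g"
  shows "square_integrable (\<lambda>t. f t + g t)"
proof -
  note [measurable] = square_integrable_measurable[OF f] square_integrable_measurable[OF g]
  have int: "integrable lborel (\<lambda>t. 2 * (cmod (f t))\<^sup>2 + 2 * (cmod (g t))\<^sup>2)"
    using f g by (auto simp: square_integrable_def)
  have bound: "(cmod (a + b))\<^sup>2 \<le> 2 * (cmod a)\<^sup>2 + 2 * (cmod b)\<^sup>2" for a b :: complex
  proof -
    have "(cmod (a + b))\<^sup>2 \<le> (cmod a + cmod b)\<^sup>2"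
      by (intro power_mono norm_triangle_ineq) simp
    also have "\<dots> \<le> 2 * (cmod a)\<^sup>2 + 2 * (cmod b)\<^sup>2"
      using zero_le_power2[of "cmod a - cmod b"] by (simp add: power2_eq_square algebra_simps)
    finally show ?thesis .
  qed
  have "integrable lborel (\<lambda>t. (cmod (f t + g t))\<^sup>2)"
    by (rule Bochner_Integration.integrable_bound[OF int]) (auto simp: bound)
  then show ?thesis by (simp add: square_integrable_def)
qed

lemma square_integrable_cmult:
  assumes f: "square_integrable f"
  shows "square_integrable (\<lambda>t. c * f t)"
  using f by (auto simp: square_integrable_def norm_mult power_mult_distrib)

lemma square_integrable_mult_cnj:
  assumes f: "square_integrable f" and g: "square_integrable g"
  shows "integrable lborel (\<lambda>t. f t * cnj (g t))"
proof -
  note [measurable] = square_integrable_measurable[OF f] square_integrable_measurable[OF g]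
  have int: "integrable lborel (\<lambda>t. (cmod (f t))\<^sup>2 + (cmod (g t))\<^sup>2)"
    using f g by (auto simp: square_integrable_def)
  have bound: "cmod a * cmod b \<le> (cmod a)\<^sup>2 + (cmod b)\<^sup>2" for a b :: complex
  proof -
    have "0 \<le> (cmod a - cmod b)\<^sup>2" by simp
    then have "2 * (cmod a * cmod b) \<le> (cmod a)\<^sup>2 + (cmod b)\<^sup>2"
      by (simp add: power2_eq_square algebra_simps)
    moreover have "0 \<le> cmod a * cmod b" by simp
    ultimately show ?thesis by linarith
  qed
  have [measurable]: "(\<lambda>t. cnj (g t)) \<in> borel_measurable borel"
    by (rule borel_measurable_continuous_on[OF continuous_on_cnj[OF continuous_on_id]]) measurable
  show ?thesis
    by (rule Bochner_Integration.integrable_bound[OF int]) (auto simp: bound norm_mult)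
qed

lemma square_integrable_modulate_shift:
  fixes f :: "'a::euclidean_space \<Rightarrow> complex"
  assumes f: "square_integrable f" and m: "m \<in> borel_measurable borel" "\<And>t. cmod (m t) = 1"
  shows "square_integrable (\<lambda>t. m t * f (t - x))"
proof -
  note [measurable] = square_integrable_measurable[OF f] m(1)
  have "integrable (distr lborel borel ((+) (- x))) (\<lambda>t. (cmod (f t))\<^sup>2)"
    using f by (simp add: lborel_distr_plus square_integrable_def)
  then have "integrable lborel (\<lambda>t. (cmod (f (- x + t)))\<^sup>2)"
    by (subst (asm) integrable_distr_eq) auto
  then show ?thesis
    by (simp add: square_integrable_def norm_mult m(2))
qed

lemma AE_lborel_shift:
  fixes x :: "'a::euclidean_space"
  assumes [measurable]: "f \<in> borel_measurable borel" "g \<in> borel_measurable borel"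
    and ae: "AE t in lborel. f t = (g t :: complex)"
  shows "AE t in lborel. f (t - x) = g (t - x)"
proof -
  have "AE t in distr lborel borel ((+) (- x)). f t = g t"
    using ae by (subst lborel_distr_plus)
  then have "AE t in lborel. f (- x + t) = g (- x + t)"
    by (subst (asm) AE_distr_iff) auto
  then show ?thesis by simp
qed

quotient_type (overloaded) 'a l2 = "'a::euclidean_space \<Rightarrow> complex" / partial: l2_rel
proof (rule part_equivpI)
  show "\<exists>f::'a \<Rightarrow> complex. l2_rel f f"
    by (rule exI[of _ "\<lambda>_. 0"]) (simp add: l2_rel_def square_integrable_zero)
  show "symp (l2_rel :: ('a \<Rightarrow> complex) \<Rightarrow> _)"
    by (auto simp: symp_def l2_rel_def elim: AE_mp)
  show "transp (l2_rel :: ('a \<Rightarrow> complex) \<Rightarrow> _)"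
    by (auto simp: transp_def l2_rel_def elim: AE_mp)
qed

text \<open>The inner product is linear in the first argument.\<close>

lift_definition cinner :: "'a::euclidean_space l2 \<Rightarrow> 'a l2 \<Rightarrow> complex" is
  "\<lambda>f g. \<integral>t. f t * cnj (g t) \<partial>lborel"
proof -
  fix f f' g g' :: "'a \<Rightarrow> complex"
  assume "l2_rel f f'" "l2_rel g g'"
  then show "(\<integral>t. f t * cnj (g t) \<partial>lborel) = (\<integral>t. f' t * cnj (g' t) \<partial>lborel)"
    unfolding l2_rel_def
    by (intro integral_cong_AE borel_measurable_integrable square_integrable_mult_cnj) auto
qed

lift_definition scaleC :: "complex \<Rightarrow> 'a::euclidean_space l2 \<Rightarrow> 'a l2" is
  "\<lambda>c f t. c * f t"
  by (auto simp: l2_rel_def intro: square_integrable_cmult elim: AE_mp)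

instantiation l2 :: (euclidean_space) real_inner
begin

lift_definition zero_l2 :: "'a l2" is "\<lambda>t. 0"
  by (simp add: l2_rel_def square_integrable_zero)

lift_definition plus_l2 :: "'a l2 \<Rightarrow> 'a l2 \<Rightarrow> 'a l2" is "\<lambda>f g t. f t + g t"
  by (auto simp: l2_rel_def intro: square_integrable_add elim: AE_mp)

definition uminus_l2 :: "'a l2 \<Rightarrow> 'a l2" where "- \<psi> = scaleC (- 1) \<psi>"

definition minus_l2 :: "'a l2 \<Rightarrow> 'a l2 \<Rightarrow> 'a l2" where "\<psi> - \<phi> = \<psi> + - (\<phi> :: 'a l2)"

definition scaleR_l2 :: "real \<Rightarrow> 'a l2 \<Rightarrow> 'a l2" where "r *\<^sub>R \<psi> = scaleC (of_real r) \<psi>"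

definition inner_l2 :: "'a l2 \<Rightarrow> 'a l2 \<Rightarrow> real" where "\<psi> \<bullet> \<phi> = Re (cinner \<psi> \<phi>)"

definition norm_l2 :: "'a l2 \<Rightarrow> real" where "norm \<psi> = sqrt (\<psi> \<bullet> (\<psi> :: 'a l2))"

definition sgn_l2 :: "'a l2 \<Rightarrow> 'a l2" where "sgn \<psi> = inverse (norm \<psi>) *\<^sub>R (\<psi> :: 'a l2)"

definition dist_l2 :: "'a l2 \<Rightarrow> 'a l2 \<Rightarrow> real" where "dist \<psi> \<phi> = norm (\<psi> - \<phi> :: 'a l2)"

definition uniformity_l2 :: "('a l2 \<times> 'a l2) filter" where
  "uniformity_l2 = (INF e\<in>{0<..}. principal {(\<psi>, \<phi>). dist \<psi> \<phi> < e})"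

definition open_l2 :: "'a l2 set \<Rightarrow> bool" where
  "open_l2 U \<longleftrightarrow> (\<forall>\<psi>\<in>U. eventually (\<lambda>(\<psi>', \<phi>). \<psi>' = \<psi> \<longrightarrow> \<phi> \<in> U) uniformity)"

instance
proof
  fix \<psi> \<phi> \<xi> :: "'a l2" and a b :: real and U :: "'a l2 set"
  show "\<psi> + \<phi> + \<xi> = \<psi> + (\<phi> + \<xi>)"
    by transfer (auto simp: l2_rel_def add.assoc intro!: square_integrable_add)
  show "\<psi> + \<phi> = \<phi> + \<psi>"
    by transfer (auto simp: l2_rel_def add.commute intro!: square_integrable_add)
  show "0 + \<psi> = \<psi>"
    by transfer (auto simp: l2_rel_def)
  show "- \<psi> + \<psi> = 0"
    unfolding uminus_l2_def
    by transfer (auto simp: l2_rel_def square_integrable_zero)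
  show "\<psi> - \<phi> = \<psi> + - \<phi>"
    by (simp add: minus_l2_def)
  show "a *\<^sub>R (\<psi> + \<phi>) = a *\<^sub>R \<psi> + a *\<^sub>R \<phi>"
    unfolding scaleR_l2_def
    by transfer (auto simp: l2_rel_def distrib_left distrib_right
        intro!: square_integrable_add square_integrable_cmult)
  show "(a + b) *\<^sub>R \<psi> = a *\<^sub>R \<psi> + b *\<^sub>R \<psi>"
    unfolding scaleR_l2_def
    by transfer (auto simp: l2_rel_def distrib_left distrib_right
        intro!: square_integrable_add square_integrable_cmult)
  show "a *\<^sub>R b *\<^sub>R \<psi> = (a * b) *\<^sub>R \<psi>"
    unfolding scaleR_l2_def
    by transfer (auto simp: l2_rel_def mult.assoc
        intro!: square_integrable_cmult[of _ "_ * _", simplified mult.assoc])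
  show "1 *\<^sub>R \<psi> = \<psi>"
    unfolding scaleR_l2_def by transfer (auto simp: l2_rel_def)
  show "sgn \<psi> = inverse (norm \<psi>) *\<^sub>R \<psi>"
    by (rule sgn_l2_def)
  show "dist \<psi> \<phi> = norm (\<psi> - \<phi>)"
    by (rule dist_l2_def)
  show "uniformity = (INF e\<in>{0<..}. principal {(\<psi>, \<phi> :: 'a l2). dist \<psi> \<phi> < e})"
    by (rule uniformity_l2_def)
  show "open U \<longleftrightarrow> (\<forall>\<psi>\<in>U. \<forall>\<^sub>F (\<psi>', \<phi>) in uniformity. \<psi>' = \<psi> \<longrightarrow> \<phi> \<in> U)"
    by (rule open_l2_def)
  have "cinner \<phi> \<psi> = cnj (cinner \<psi> \<phi>)"
    by transfer (subst Bochner_Integration.integral_cnj[symmetric], simp add: mult.commute)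
  then show "\<psi> \<bullet> \<phi> = \<phi> \<bullet> \<psi>"
    by (simp add: inner_l2_def)
  have "cinner (\<psi> + \<phi>) \<xi> = cinner \<psi> \<xi> + cinner \<phi> \<xi>"
    by transfer (auto simp: l2_rel_def distrib_right
        intro!: Bochner_Integration.integral_add square_integrable_mult_cnj)
  then show "(\<psi> + \<phi>) \<bullet> \<xi> = \<psi> \<bullet> \<xi> + \<phi> \<bullet> \<xi>"
    by (simp add: inner_l2_def)
  have "cinner (scaleC (of_real a) \<psi>) \<phi> = of_real a * cinner \<psi> \<phi>"
    by transfer (auto simp: l2_rel_def mult.assoc)
  then show "(a *\<^sub>R \<psi>) \<bullet> \<phi> = a * (\<psi> \<bullet> \<phi>)"
    by (simp add: inner_l2_def scaleR_l2_def)
  have eq: "Re (\<integral>t. f t * cnj (f t) \<partial>lborel) = (\<integral>t. (cmod (f t))\<^sup>2 \<partial>lborel)"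
    for f :: "'a \<Rightarrow> complex"
    unfolding complex_norm_square[symmetric] integral_complex_of_real by simp
  show "0 \<le> \<psi> \<bullet> \<psi>"
    unfolding inner_l2_def by transfer (simp add: eq)
  show "\<psi> \<bullet> \<psi> = 0 \<longleftrightarrow> \<psi> = 0"
    unfolding inner_l2_def
  proof transfer
    fix f :: "'a \<Rightarrow> complex"
    assume "l2_rel f f"
    then have f: "square_integrable f" by (simp add: l2_rel_def)
    then have "(\<integral>t. (cmod (f t))\<^sup>2 \<partial>lborel) = 0 \<longleftrightarrow> (AE t in lborel. (cmod (f t))\<^sup>2 = 0)"
      by (intro integral_nonneg_eq_0_iff_AE) (auto simp: square_integrable_def)
    then show "Re (\<integral>t. f t * cnj (f t) \<partial>lborel) = 0 \<longleftrightarrow> l2_rel f (\<lambda>t. 0)"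
      using f by (simp add: eq l2_rel_def square_integrable_zero)
  qed
  show "norm \<psi> = sqrt (\<psi> \<bullet> \<psi>)"
    by (rule norm_l2_def)
qed

end


section \<open>Trace-class operators\<close>

definition bounded_op :: "('a::euclidean_space l2 \<Rightarrow> 'a l2) \<Rightarrow> bool" where
  "bounded_op T \<longleftrightarrow> bounded_linear T \<and> (\<forall>c \<psi>. T (scaleC c \<psi>) = scaleC c (T \<psi>))"

definition adj :: "('a::euclidean_space l2 \<Rightarrow> 'a l2) \<Rightarrow> 'a l2 \<Rightarrow> 'a l2" where
  "adj T = (THE B. \<forall>\<psi> \<phi>. cinner (T \<psi>) \<phi> = cinner \<psi> (B \<phi>))"

definition positive_op :: "('a::euclidean_space l2 \<Rightarrow> 'a l2) \<Rightarrow> bool" where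
  "positive_op P \<longleftrightarrow> bounded_op P \<and> (\<forall>\<psi>. cinner (P \<psi>) \<psi> \<in> \<real>\<^sub>\<ge>\<^sub>0)"

definition is_onb :: "'a::euclidean_space l2 set \<Rightarrow> bool" where
  "is_onb E \<longleftrightarrow>
     (\<forall>e\<in>E. \<forall>f\<in>E. cinner e f = (if e = f then 1 else 0)) \<and>
     (\<forall>\<psi>. (\<forall>e\<in>E. cinner \<psi> e = 0) \<longrightarrow> \<psi> = 0)"

text \<open>
  The operator \<open>P\<close> below is the absolute value of \<open>T\<close>, that is, the unique positive square root of
  \<open>adj T \<circ> T\<close>. Whether the sum is finite does not depend on the orthonormal basis.
\<close>

definition trace_class :: "('a::euclidean_space l2 \<Rightarrow> 'a l2) \<Rightarrow> bool" where
  "trace_class T \<longleftrightarrow> bounded_op T \<and>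
     (\<exists>P. positive_op P \<and> P \<circ> P = adj T \<circ> T \<and>
        (\<exists>E. is_onb E \<and> (\<lambda>e. cinner (P e) e) summable_on E))"

text \<open>For trace-class operators the value does not depend on the chosen orthonormal basis.\<close>

definition trace :: "('a::euclidean_space l2 \<Rightarrow> 'a l2) \<Rightarrow> complex" where
  "trace T = (\<Sum>\<^sub>\<infinity>e\<in>(SOME E. is_onb E). cinner (T e) e)"


section \<open>Bounded complex Borel measures\<close>

text \<open>Only the values on Borel sets matter; the empty set gets value 0 by countable additivity.\<close>

definition complex_measure :: "('a::topological_space set \<Rightarrow> complex) \<Rightarrow> bool" where
  "complex_measure \<mu> \<longleftrightarrow>
     (\<forall>A :: nat \<Rightarrow> 'a set. range A \<subseteq> sets borel \<and> disjoint_family A \<longrightarrow>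
        (\<lambda>i. \<mu> (A i)) sums \<mu> (\<Union>i. A i)) \<and>
     (\<exists>C. \<forall>A\<in>sets borel. cmod (\<mu> A) \<le> C)"

text \<open>
  The positive part of the Jordan decomposition of a real-valued measure \<open>\<nu>\<close>; the negative part is
  the positive part of \<open>- \<nu>\<close>.
\<close>

definition pos_variation :: "('a::topological_space set \<Rightarrow> real) \<Rightarrow> 'a measure" where
  "pos_variation \<nu> = measure_of UNIV (sets borel)
     (\<lambda>A. SUP B\<in>{B \<in> sets borel. B \<subseteq> A}. ennreal (\<nu> B))"

definition signed_integral ::
    "('a::topological_space set \<Rightarrow> real) \<Rightarrow> ('a \<Rightarrow> complex) \<Rightarrow> complex" where
  "signed_integral \<nu> f =
     (\<integral>z. f z \<partial>pos_variation \<nu>) - (\<integral>z. f z \<partial>pos_variation (\<lambda>A. - \<nu> A))"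

definition cm_integral ::
    "('a::topological_space set \<Rightarrow> complex) \<Rightarrow> ('a \<Rightarrow> complex) \<Rightarrow> complex" where
  "cm_integral \<mu> f =
     signed_integral (\<lambda>A. Re (\<mu> A)) f + \<i> * signed_integral (\<lambda>A. Im (\<mu> A)) f"


section \<open>Time-frequency shifts, convolutions and Fourier transforms\<close>

text \<open>Points of phase space are pairs \<open>z = (x, \<omega>)\<close>.\<close>

lift_definition tf_shift :: "'a::euclidean_space \<times> 'a \<Rightarrow> 'a l2 \<Rightarrow> 'a l2" is
  "\<lambda>(x, \<omega>) f t. exp (2 * of_real pi * \<i> * of_real (\<omega> \<bullet> t)) * f (t - x)"
proof (clarify)
  fix x \<omega> :: 'a and f g :: "'a \<Rightarrow> complex"
  assume fg: "l2_rel f g"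
  then have "AE t in lborel. f (t - x) = g (t - x)"
    by (intro AE_lborel_shift) (auto simp: l2_rel_def square_integrable_def)
  with fg show "l2_rel (\<lambda>t. exp (2 * of_real pi * \<i> * of_real (\<omega> \<bullet> t)) * f (t - x))
                (\<lambda>t. exp (2 * of_real pi * \<i> * of_real (\<omega> \<bullet> t)) * g (t - x))"
    by (auto simp: l2_rel_def intro!: square_integrable_modulate_shift)
qed

text \<open>
  The weak equation determines the operator uniquely since \<^const>\<open>cinner\<close> is nondegenerate; for a
  bounded operator and a bounded complex measure it exists by the Riesz representation theorem.
\<close>

definition measure_conv ::
    "(('a::euclidean_space \<times> 'a) set \<Rightarrow> complex) \<Rightarrow> ('a l2 \<Rightarrow> 'a l2) \<Rightarrow> 'a l2 \<Rightarrow> 'a l2"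
    (infixl \<open>\<star>\<close> 70) where
  "\<mu> \<star> S = (THE T. \<forall>\<psi> \<phi>. cinner (T \<psi>) \<phi> =
     cm_integral \<mu> (\<lambda>z. cinner (tf_shift z (S (adj (tf_shift z) \<psi>))) \<phi>))"

definition fourier_wigner ::
    "('a::euclidean_space l2 \<Rightarrow> 'a l2) \<Rightarrow> 'a \<times> 'a \<Rightarrow> complex" where
  "fourier_wigner S = (\<lambda>(x, \<omega>).
     exp (- of_real pi * \<i> * of_real (x \<bullet> \<omega>)) * trace (tf_shift (- (x, \<omega>)) \<circ> S))"

fun symplectic :: "'a::euclidean_space \<times> 'a \<Rightarrow> 'a \<times> 'a \<Rightarrow> real" where
  "symplectic (x, \<omega>) (x', \<omega>') = \<omega> \<bullet> x' - \<omega>' \<bullet> x"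

definition symplectic_fourier ::
    "(('a::euclidean_space \<times> 'a) set \<Rightarrow> complex) \<Rightarrow> 'a \<times> 'a \<Rightarrow> complex" where
  "symplectic_fourier \<mu> z =
     cm_integral \<mu> (\<lambda>z'. exp (- 2 * of_real pi * \<i> * of_real (symplectic z z')))"

end

theory Submission
  imports Defs
begin

text \<open>
  Formally the identity is one line. For \<open>A = tf_shift (- w)\<close>, the commutation relation
  (\<open>tf_shift_commute\<close>) gives \<open>A (tf_shift z) = \<gamma> z (tf_shift z) A\<close>, where \<open>\<gamma> z\<close> is the exponential
  of \<open>- 2 \<pi> \<i> symplectic w z\<close>; since the trace is invariant under conjugation by a unitary, the trace of
  \<open>A (tf_shift z) S (adj (tf_shift z))\<close> is \<open>\<gamma> z\<close> times the trace of \<open>A S\<close>. Integrating over \<open>z\<close>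
  gives the symplectic Fourier transform of \<open>\<mu>\<close> times the trace of \<open>A S\<close>; the remaining phase in the
  Fourier--Wigner transform is the same on both sides. The work lies in showing that the convolution
  exists, that traces do not depend on the basis, and that the trace may be taken under the integral.

  All three follow once \<open>S\<close> is written as a sum of rank-one operators
  \<open>\<psi> \<mapsto> cinner \<psi> (a n) b n\<close> with summable norms (\<open>trace_class_nuclear\<close>). This
  decomposition comes from Cholesky elimination of the absolute value of \<open>S\<close> along an orthonormal
  basis, with the steps transported to \<open>S\<close>.

  Given the decomposition, Bessel's inequality bounds the sum of the absolute values of the diagonal
  entries of \<open>A S\<close> by one constant for all orthonormal bases at once (\<open>nuclear_diagonal_bound\<close>), and
  Parseval's identity shows that the diagonal entries sum to the same value in every basis
  (\<open>nuclear_diagonal_sums\<close>). Replacing \<open>S\<close> by its conjugate at the point \<open>z\<close> only rotates the basis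
  and multiplies by \<open>\<gamma> z\<close>, so the uniform bound is exactly the domination that is needed to interchange
  the sum over the basis with the integral over \<open>z\<close> (\<open>cm_integral_sums\<close>). Dominated convergence is
  about sequences, hence the detour through separability: every orthonormal basis is
  countable (\<open>countable_onb\<close>).

  The convolution and the adjoints are obtained from Riesz representation, which rests on the
  completeness of the space (\<open>l2_Cauchy_convergent\<close>).
\<close>

section \<open>The complex inner product space\<close>

lemma cinner_commute: "cinner \<phi> \<psi> = cnj (cinner \<psi> \<phi>)"
  by transfer (subst Bochner_Integration.integral_cnj[symmetric], simp add: mult.commute)

lemma cinner_add_left: "cinner (\<psi> + \<phi>) \<xi> = cinner \<psi> \<xi> + cinner \<phi> \<xi>"
  by transfer (auto simp: l2_rel_def distrib_right
      intro!: Bochner_Integration.integral_add square_integrable_mult_cnj)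

lemma cinner_scaleC_left: "cinner (scaleC c \<psi>) \<phi> = c * cinner \<psi> \<phi>"
  by transfer (auto simp: l2_rel_def mult.assoc)

lemma cinner_add_right: "cinner \<xi> (\<psi> + \<phi>) = cinner \<xi> \<psi> + cinner \<xi> \<phi>"
  by (metis cinner_commute cinner_add_left complex_cnj_add)

lemma cinner_scaleC_right: "cinner \<psi> (scaleC c \<phi>) = cnj c * cinner \<psi> \<phi>"
  by (metis cinner_commute cinner_scaleC_left complex_cnj_mult)

lemma cinner_zero_left [simp]: "cinner 0 \<psi> = 0"
  using cinner_add_left[of 0 0 \<psi>] by simp

lemma cinner_zero_right [simp]: "cinner \<psi> 0 = 0"
  by (subst cinner_commute) simp

lemma cinner_uminus_left: "cinner (- \<psi>) \<phi> = - cinner \<psi> \<phi>"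
  using cinner_add_left[of \<psi> "- \<psi>" \<phi>] by (simp add: add_eq_0_iff)

lemma cinner_uminus_right: "cinner \<psi> (- \<phi>) = - cinner \<psi> \<phi>"
  using cinner_add_right[of \<psi> \<phi> "- \<phi>"] by (simp add: add_eq_0_iff)

lemma cinner_diff_left: "cinner (\<psi> - \<phi>) \<xi> = cinner \<psi> \<xi> - cinner \<phi> \<xi>"
  using cinner_add_left[of \<psi> "- \<phi>" \<xi>] by (simp add: cinner_uminus_left)

lemma cinner_diff_right: "cinner \<xi> (\<psi> - \<phi>) = cinner \<xi> \<psi> - cinner \<xi> \<phi>"
  using cinner_add_right[of \<xi> \<psi> "- \<phi>"] by (simp add: cinner_uminus_right)

lemma cinner_sum_left: "cinner (\<Sum>i\<in>I. f i) \<xi> = (\<Sum>i\<in>I. cinner (f i) \<xi>)"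
  by (induction I rule: infinite_finite_induct) (auto simp: cinner_add_left)

lemma cinner_sum_right: "cinner \<xi> (\<Sum>i\<in>I. f i) = (\<Sum>i\<in>I. cinner \<xi> (f i))"
  by (induction I rule: infinite_finite_induct) (auto simp: cinner_add_right)

lemma cinner_self: "cinner \<psi> \<psi> = of_real ((norm \<psi>)\<^sup>2)"
proof -
  have "Im (cinner \<psi> \<psi>) = 0"
    using arg_cong[OF cinner_commute[of \<psi> \<psi>], of Im] by simp
  moreover have "Re (cinner \<psi> \<psi>) = (norm \<psi>)\<^sup>2"
    by (simp add: power2_norm_eq_inner inner_l2_def)
  ultimately show ?thesis by (simp add: complex_eq_iff)
qed

lemma cinner_ext_left: "(\<And>\<phi>. cinner \<psi> \<phi> = cinner \<psi>' \<phi>) \<Longrightarrow> \<psi> = \<psi>'"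
proof -
  assume "\<And>\<phi>. cinner \<psi> \<phi> = cinner \<psi>' \<phi>"
  then have "cinner (\<psi> - \<psi>') (\<psi> - \<psi>') = 0" by (simp add: cinner_diff_left)
  then show ?thesis by (simp add: cinner_self)
qed

lemma cinner_ext_right: "(\<And>\<phi>. cinner \<phi> \<psi> = cinner \<phi> \<psi>') \<Longrightarrow> \<psi> = \<psi>'"
  by (rule cinner_ext_left) (metis cinner_commute)

lemma scaleC_scaleC: "scaleC c (scaleC d \<psi>) = scaleC (c * d) \<psi>"
  by (rule cinner_ext_left) (simp add: cinner_scaleC_left)

lemma scaleC_one [simp]: "scaleC 1 \<psi> = \<psi>"
  by (rule cinner_ext_left) (simp add: cinner_scaleC_left)

lemma scaleC_zero_left [simp]: "scaleC 0 \<psi> = 0"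
  by (rule cinner_ext_left) (simp add: cinner_scaleC_left)

lemma scaleC_zero_right [simp]: "scaleC c 0 = 0"
  by (rule cinner_ext_left) (simp add: cinner_scaleC_left)

lemma norm_scaleC: "norm (scaleC c \<psi>) = cmod c * norm \<psi>"
proof -
  have "complex_of_real ((norm (scaleC c \<psi>))\<^sup>2) = c * cnj c * of_real ((norm \<psi>)\<^sup>2)"
    unfolding cinner_self[symmetric] by (simp add: cinner_scaleC_left cinner_scaleC_right)
  also have "\<dots> = of_real ((cmod c * norm \<psi>)\<^sup>2)"
    by (simp add: complex_norm_square[symmetric] power_mult_distrib)
  finally have "(norm (scaleC c \<psi>))\<^sup>2 = (cmod c * norm \<psi>)\<^sup>2"
    by (simp only: of_real_eq_iff)
  then show ?thesis by simp
qed

lemma cinner_Cauchy_Schwarz: "cmod (cinner \<psi> \<phi>) \<le> norm \<psi> * norm \<phi>"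
proof (cases "cinner \<psi> \<phi> = 0")
  case False
  \<comment> \<open>a phase that turns the complex inner product into the real one\<close>
  define c where "c = cnj (cinner \<psi> \<phi>) / cmod (cinner \<psi> \<phi>)"
  have c: "cmod c = 1" using False by (simp add: c_def norm_divide)
  have "cinner (scaleC c \<psi>) \<phi> = cmod (cinner \<psi> \<phi>)"
    using False complex_norm_square[of "cinner \<psi> \<phi>"]
    by (simp add: cinner_scaleC_left c_def field_simps power2_eq_square)
  then have "cmod (cinner \<psi> \<phi>) = scaleC c \<psi> \<bullet> \<phi>"
    by (simp add: inner_l2_def)
  also have "\<dots> \<le> norm (scaleC c \<psi>) * norm \<phi>" by (rule norm_cauchy_schwarz)
  finally show ?thesis by (simp add: norm_scaleC c)
qed simp

lemma tendsto_cinner: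
  assumes "(f \<longlongrightarrow> \<psi>) F" shows "((\<lambda>n. cinner (f n) \<phi>) \<longlongrightarrow> cinner \<psi> \<phi>) F"
proof (rule Lim_null_comparison[THEN LIM_zero_cancel])
  show "\<forall>\<^sub>F n in F. norm (cinner (f n) \<phi> - cinner \<psi> \<phi>) \<le> norm (f n - \<psi>) * norm \<phi>"
    by (intro always_eventually allI) (metis cinner_Cauchy_Schwarz cinner_diff_left)
  show "((\<lambda>n. norm (f n - \<psi>) * norm \<phi>) \<longlongrightarrow> 0) F"
    using assms tendsto_mult_left_zero tendsto_norm_zero LIM_zero by blast
qed

section \<open>Completeness\<close>

text \<open>
  Measure-theoretic arguments about norms go through this formula: it is stated with the nonnegative
  integral so that monotone convergence and Fatou's lemma apply directly.
\<close>

lemma norm_abs_l2: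
  assumes "square_integrable f" "square_integrable g"
  shows "ennreal ((norm (abs_l2 f - abs_l2 g))\<^sup>2) = (\<integral>\<^sup>+t. ennreal ((cmod (f t - g t))\<^sup>2) \<partial>lborel)"
proof -
  define h where "h = (\<lambda>t. f t + - 1 * g t)"
  have h: "square_integrable h"
    unfolding h_def using assms by (intro square_integrable_add square_integrable_cmult)
  have rel: "l2_rel k k" if "square_integrable k" for k :: "'a \<Rightarrow> complex"
    using that by (simp add: l2_rel_def)
  have "abs_l2 f - abs_l2 g = abs_l2 h"
    unfolding minus_l2_def uminus_l2_def h_def using assms
    by (simp add: scaleC.abs_eq plus_l2.abs_eq rel square_integrable_cmult square_integrable_cmult[of g "-1", simplified])
  then have "(norm (abs_l2 f - abs_l2 g))\<^sup>2 = Re (\<integral>t. h t * cnj (h t) \<partial>lborel)"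
    by (simp add: power2_norm_eq_inner inner_l2_def cinner.abs_eq rel h)
  also have "\<dots> = (\<integral>t. (cmod (h t))\<^sup>2 \<partial>lborel)"
    unfolding complex_norm_square[symmetric] integral_complex_of_real by simp
  finally have "ennreal ((norm (abs_l2 f - abs_l2 g))\<^sup>2) = (\<integral>\<^sup>+t. ennreal ((cmod (h t))\<^sup>2) \<partial>lborel)"
    using h by (simp add: nn_integral_eq_integral square_integrable_def)
  then show ?thesis by (simp add: h_def)
qed

lemma l2_representative: "\<exists>f. square_integrable f \<and> \<psi> = abs_l2 f"
  using Quotient_rep_reflp[OF Quotient_l2, of \<psi>] Quotient_abs_rep[OF Quotient_l2, of \<psi>]
  by (intro exI[of _ "rep_l2 \<psi>"]) (simp add: l2_rel_def)

text \<open>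
  The Riesz--Fischer theorem. Along a subsequence whose increments have norm at most \<open>(1 / 4) ^ n\<close>, the
  squared increments weighted by \<open>4 ^ n\<close> still have a finite total integral, so at almost every point
  the increments are dominated by a geometric series and the subsequence converges. Fatou's lemma
  turns the pointwise limit into a limit in norm.
\<close>

lemma l2_Cauchy_convergent:
  fixes X :: "nat \<Rightarrow> 'a::euclidean_space l2"
  assumes X: "Cauchy X"
  shows "convergent X"
proof -
  have "\<forall>n. \<exists>N. \<forall>m\<ge>N. \<forall>k\<ge>N. norm (X m - X k) < (1 / 4) ^ n"
    using X unfolding Cauchy_iff by (auto simp: zero_less_power)
  then obtain N where N: "\<And>n m k. m \<ge> N n \<Longrightarrow> k \<ge> N n \<Longrightarrow> norm (X m - X k) < (1 / 4) ^ n"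
    by metis
  \<comment> \<open>Any strictly increasing choice above all of \<open>N 0\<close>, \<dots>, \<open>N n\<close> would do.\<close>
  define r where "r n = n + (\<Sum>k\<le>n. N k)" for n
  have r: "strict_mono r"
    by (rule strict_monoI_Suc) (simp add: r_def)
  have rN: "r n \<ge> N n" for n
    unfolding r_def by (simp add: sum.atMost_shift[symmetric] trans_le_add2 member_le_sum)
  have rS: "norm (X (r (Suc n)) - X (r n)) < (1 / 4) ^ n" for n
    using N[OF order_trans[OF rN strict_mono_less_eq[OF r, THEN iffD2]] rN, of n "Suc n"] by simp
  obtain f where f: "\<And>n. square_integrable (f n)" and Xf: "\<And>n. X (r n) = abs_l2 (f n)"
    using l2_representative[of "X (r _)"] by metis
  note [measurable] = square_integrable_measurable[OF f]
  have nf: "(\<integral>\<^sup>+t. ennreal ((cmod (f n t - f m t))\<^sup>2) \<partial>lborel) = ennreal ((norm (X (r n) - X (r m)))\<^sup>2)"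
    for n m by (simp add: norm_abs_l2[OF f f] Xf)
  define d where "d n t = (cmod (f (Suc n) t - f n t))\<^sup>2" for n t
  have [measurable]: "d n \<in> borel_measurable borel" for n
    unfolding d_def by measurable
  have d0: "d n t \<ge> 0" for n t by (simp add: d_def)
  have dint: "(\<integral>\<^sup>+t. ennreal (4 ^ n * d n t) \<partial>lborel) \<le> ennreal ((1 / 4) ^ n)" for n
  proof -
    have "(\<integral>\<^sup>+t. ennreal (4 ^ n * d n t) \<partial>lborel) = ennreal (4 ^ n) * (\<integral>\<^sup>+t. ennreal (d n t) \<partial>lborel)"
      by (simp add: ennreal_mult d0 nn_integral_cmult)
    also have "\<dots> = ennreal (4 ^ n * (norm (X (r (Suc n)) - X (r n)))\<^sup>2)"
      by (simp add: d_def nf ennreal_mult)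
    also have "\<dots> \<le> ennreal (4 ^ n * ((1 / 4) ^ n)\<^sup>2)"
      using rS[of n] by (intro ennreal_leI mult_left_mono power_mono) auto
    also have "4 ^ n * ((1 / 4) ^ n)\<^sup>2 = (1 / 4 :: real) ^ n"
      by (simp add: power2_eq_square field_simps power_mult_distrib[symmetric])
    finally show ?thesis .
  qed
  have "(\<integral>\<^sup>+t. (\<Sum>n. ennreal (4 ^ n * d n t)) \<partial>lborel) = (\<Sum>n. \<integral>\<^sup>+t. ennreal (4 ^ n * d n t) \<partial>lborel)"
    by (rule nn_integral_suminf) measurable
  also have "\<dots> \<le> (\<Sum>n. ennreal ((1 / 4) ^ n))"
    by (intro suminf_le dint) auto
  also have "\<dots> = ennreal (\<Sum>n. (1 / 4) ^ n)"
    by (intro suminf_ennreal2) (auto intro: summable_geometric)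
  finally have "(\<integral>\<^sup>+t. (\<Sum>n. ennreal (4 ^ n * d n t)) \<partial>lborel) \<noteq> \<infinity>"
    by (auto simp: top_unique)
  then have "AE t in lborel. (\<Sum>n. ennreal (4 ^ n * d n t)) \<noteq> \<infinity>"
    by (intro nn_integral_noteq_infinite) measurable
  then have conv: "AE t in lborel. convergent (\<lambda>n. f n t)"
  proof (rule AE_mp, intro AE_I2 impI)
    fix t assume fin: "(\<Sum>n. ennreal (4 ^ n * d n t)) \<noteq> \<infinity>"
    define K where "K = enn2real (\<Sum>n. ennreal (4 ^ n * d n t))"
    have dK: "d n t \<le> K * (1 / 4) ^ n" for n
    proof -
      have "ennreal (4 ^ n * d n t) = (\<Sum>k\<in>{n}. ennreal (4 ^ k * d k t))" by simp
      also have "\<dots> \<le> (\<Sum>n. ennreal (4 ^ n * d n t))"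
        by (intro sum_le_suminf) auto
      also have "\<dots> = ennreal K" using fin by (simp add: K_def less_top)
      finally have "4 ^ n * d n t \<le> K" by (simp add: K_def)
      then show ?thesis by (simp add: field_simps)
    qed
    have bd: "cmod (f (Suc n) t - f n t) \<le> sqrt K * (1 / 2) ^ n" for n
    proof -
      have "cmod (f (Suc n) t - f n t) = sqrt (d n t)" by (simp add: d_def)
      also have "\<dots> \<le> sqrt (K * ((1 / 2) ^ n)\<^sup>2)"
        using dK[of n] by (simp add: power_mult_distrib[symmetric] power2_eq_square)
      also have "\<dots> = sqrt K * (1 / 2) ^ n"
        by (simp only: real_sqrt_mult real_sqrt_abs) simp
      finally show ?thesis .
    qed
    have "summable (\<lambda>n. sqrt K * (1 / 2 :: real) ^ n)"
      by (rule summable_mult) (rule summable_geometric, simp)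
    then have "summable (\<lambda>n. f (Suc n) t - f n t)"
      by (rule summable_comparison_test'[OF _ bd])
    then have "convergent (\<lambda>n. \<Sum>k<n. f (Suc k) t - f k t)"
      by (simp add: summable_iff_convergent)
    then have "convergent (\<lambda>n. f n t - f 0 t)"
      by (simp only: sum_lessThan_telescope[of "\<lambda>k. f k t" for t])
    from convergent_add[OF this convergent_const[of "f 0 t"]] show "convergent (\<lambda>n. f n t)"
      by simp
  qed
  define g where "g t = lim (\<lambda>n. f n t)" for t
  have g_meas [measurable]: "g \<in> borel_measurable borel"
    unfolding g_def by measurable
  have lim: "AE t in lborel. (\<lambda>n. f n t) \<longlonglongrightarrow> g t"
    using conv by eventually_elim (simp add: g_def convergent_LIMSEQ_iff)
  have fatou: "(\<integral>\<^sup>+t. ennreal ((cmod (f n t - g t))\<^sup>2) \<partial>lborel) \<le> ennreal (e\<^sup>2)"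
    if e: "\<And>m. m \<ge> n \<Longrightarrow> norm (X (r n) - X (r m)) \<le> e" for n e
  proof -
    have "(\<integral>\<^sup>+t. ennreal ((cmod (f n t - g t))\<^sup>2) \<partial>lborel)
        = (\<integral>\<^sup>+t. liminf (\<lambda>m. ennreal ((cmod (f n t - f m t))\<^sup>2)) \<partial>lborel)"
    proof (rule nn_integral_cong_AE, use lim in eventually_elim)
      fix t assume "(\<lambda>m. f m t) \<longlonglongrightarrow> g t"
      then have "(\<lambda>m. ennreal ((cmod (f n t - f m t))\<^sup>2)) \<longlonglongrightarrow> ennreal ((cmod (f n t - g t))\<^sup>2)"
        by (intro tendsto_intros)
      then show "ennreal ((cmod (f n t - g t))\<^sup>2) = liminf (\<lambda>m. ennreal ((cmod (f n t - f m t))\<^sup>2))"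
        by (intro lim_imp_Liminf[symmetric]) auto
    qed
    also have "\<dots> \<le> liminf (\<lambda>m. \<integral>\<^sup>+t. ennreal ((cmod (f n t - f m t))\<^sup>2) \<partial>lborel)"
      by (rule nn_integral_liminf) measurable
    also have "\<dots> \<le> ennreal (e\<^sup>2)"
      unfolding nf
    proof (rule order_trans[OF Liminf_le_Limsup Limsup_bounded], simp, rule eventually_mono[OF eventually_ge_at_top[of n]])
      fix m assume "n \<le> m"
      then show "ennreal ((norm (X (r n) - X (r m)))\<^sup>2) \<le> ennreal (e\<^sup>2)"
        by (intro ennreal_leI power_mono e) auto
    qed
    finally show ?thesis .
  qed
  have "norm (X (r 0) - X (r m)) \<le> 1" for m
    using N[of 0 "r 0" "r m"] rN[of 0] strict_mono_less_eq[OF r, of 0 m] by (simp add: less_imp_le)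
  then have "(\<integral>\<^sup>+t. ennreal ((cmod (f 0 t - g t))\<^sup>2) \<partial>lborel) \<le> ennreal (1\<^sup>2)"
    by (rule fatou)
  then have "(\<integral>\<^sup>+t. ennreal ((cmod (f 0 t - g t))\<^sup>2) \<partial>lborel) < \<infinity>"
    by (rule order.strict_trans1) simp
  then have "square_integrable (\<lambda>t. f 0 t - g t)"
    unfolding square_integrable_def by (auto intro!: integrableI_nonneg)
  from square_integrable_add[OF f[of 0] square_integrable_cmult[OF this, of "-1"]]
  have g: "square_integrable g" by simp
  have "(X \<circ> r) \<longlonglongrightarrow> abs_l2 g"
  proof (rule LIMSEQ_I)
    fix e :: real assume e: "e > 0"
    obtain M where M: "\<And>m k. m \<ge> M \<Longrightarrow> k \<ge> M \<Longrightarrow> norm (X m - X k) < e / 2"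
      using X e unfolding Cauchy_iff by (meson half_gt_zero)
    have "norm ((X \<circ> r) n - abs_l2 g) < e" if "n \<ge> M" for n
    proof -
      have "norm (X (r n) - X (r m)) \<le> e / 2" if "n \<le> m" for m
        using M[of "r n" "r m"] that \<open>n \<ge> M\<close> strict_mono_imp_increasing[OF r, of n]
          strict_mono_imp_increasing[OF r, of m] by simp
      then have "(\<integral>\<^sup>+t. ennreal ((cmod (f n t - g t))\<^sup>2) \<partial>lborel) \<le> ennreal ((e / 2)\<^sup>2)"
        by (rule fatou)
      then have "(norm (X (r n) - abs_l2 g))\<^sup>2 \<le> (e / 2)\<^sup>2"
        by (simp add: norm_abs_l2[OF f g, symmetric] Xf)
      then have "norm (X (r n) - abs_l2 g) \<le> e / 2"
        using e by (simp add: power2_le_iff_abs_le)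
      then show ?thesis using e by simp
    qed
    then show "\<exists>M. \<forall>n\<ge>M. norm ((X \<circ> r) n - abs_l2 g) < e" by blast
  qed
  then show ?thesis
    using Cauchy_converges_subseq[OF X r] by (auto simp: convergent_def)
qed

instance l2 :: (euclidean_space) banach
  by standard (rule l2_Cauchy_convergent)

section \<open>Orthonormal bases and separability\<close>

text \<open>
  The zero vector is admitted as a member, repeatedly if need be, so that finite and infinite
  orthonormal systems can all be enumerated by the natural numbers.
\<close>

definition orthonormal_family :: "'i set \<Rightarrow> ('i \<Rightarrow> 'a::euclidean_space l2) \<Rightarrow> bool" where
  "orthonormal_family I e \<longleftrightarrow>
     (\<forall>i\<in>I. \<forall>j\<in>I. i \<noteq> j \<longrightarrow> cinner (e i) (e j) = 0) \<and> (\<forall>i\<in>I. e i = 0 \<or> norm (e i) = 1)"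

lemma orthonormal_family_mono: "orthonormal_family I e \<Longrightarrow> J \<subseteq> I \<Longrightarrow> orthonormal_family J e"
  unfolding orthonormal_family_def by blast

lemma cinner_orthonormal_sum:
  assumes e: "orthonormal_family I e" and I: "finite I" and j: "j \<in> I"
  shows "cinner (\<Sum>i\<in>I. scaleC (c i) (e i)) (e j) = c j * of_real ((norm (e j))\<^sup>2)"
proof -
  have "cinner (\<Sum>i\<in>I. scaleC (c i) (e i)) (e j)
      = (\<Sum>i\<in>I. if i = j then c j * of_real ((norm (e j))\<^sup>2) else 0)"
    unfolding cinner_sum_left cinner_scaleC_left
    using e j by (intro sum.cong refl) (auto simp: cinner_self orthonormal_family_def)
  then show ?thesis using I j by simp
qed

lemma norm_orthonormal_sum:
  assumes e: "orthonormal_family I e" and I: "finite I"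
  shows "(norm (\<Sum>i\<in>I. scaleC (c i) (e i)))\<^sup>2 = (\<Sum>i\<in>I. (cmod (c i))\<^sup>2 * (norm (e i))\<^sup>2)"
proof -
  let ?s = "\<Sum>i\<in>I. scaleC (c i) (e i)"
  have "complex_of_real ((norm ?s)\<^sup>2) = (\<Sum>j\<in>I. cnj (c j) * cinner ?s (e j))"
    unfolding cinner_self[symmetric] cinner_sum_right[of ?s] cinner_scaleC_right ..
  also have "\<dots> = (\<Sum>j\<in>I. of_real ((cmod (c j))\<^sup>2 * (norm (e j))\<^sup>2))"
    by (intro sum.cong refl)
       (simp only: cinner_orthonormal_sum[OF e I] of_real_mult complex_norm_square mult_ac)
  finally show ?thesis by (simp only: of_real_sum[symmetric] of_real_eq_iff)
qed

lemma norm_orthonormal_sum_le: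
  assumes e: "orthonormal_family I e" and I: "finite I"
  shows "(norm (\<Sum>i\<in>I. scaleC (c i) (e i)))\<^sup>2 \<le> (\<Sum>i\<in>I. (cmod (c i))\<^sup>2)"
  unfolding norm_orthonormal_sum[OF e I]
proof (rule sum_mono)
  fix i assume "i \<in> I"
  then have "norm (e i) \<in> {0, 1}" using e by (auto simp: orthonormal_family_def)
  then show "(cmod (c i))\<^sup>2 * (norm (e i))\<^sup>2 \<le> (cmod (c i))\<^sup>2" by auto
qed

lemma Bessel_inequality:
  assumes e: "orthonormal_family I e" and I: "finite I"
  shows "(\<Sum>i\<in>I. (cmod (cinner \<psi> (e i)))\<^sup>2) \<le> (norm \<psi>)\<^sup>2"
proof -
  define s where "s = (\<Sum>i\<in>I. scaleC (cinner \<psi> (e i)) (e i))"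
  define b where "b = (\<Sum>i\<in>I. (cmod (cinner \<psi> (e i)))\<^sup>2)"
  have ps: "cinner \<psi> s = of_real b"
    unfolding s_def b_def cinner_sum_right cinner_scaleC_right of_real_sum complex_norm_square
    by (simp add: mult.commute)
  then have sp: "cinner s \<psi> = of_real b"
    by (subst cinner_commute) simp
  have "complex_of_real ((norm (\<psi> - s))\<^sup>2)
      = of_real ((norm \<psi>)\<^sup>2 - b - b + (norm s)\<^sup>2)"
    unfolding cinner_self[symmetric] cinner_diff_left cinner_diff_right ps sp
    by (simp add: cinner_self)
  then have "(norm (\<psi> - s))\<^sup>2 = (norm \<psi>)\<^sup>2 - b - b + (norm s)\<^sup>2"
    by (simp only: of_real_eq_iff)
  moreover have "(norm s)\<^sup>2 \<le> b"
    unfolding s_def b_def by (rule norm_orthonormal_sum_le[OF e I])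
  ultimately show ?thesis
    using zero_le_power2[of "norm (\<psi> - s)"] unfolding b_def[symmetric] by linarith
qed

text \<open>
  This bound is uniform in the orthonormal family; it provides the dominating series and the dominating
  constant in every later interchange of limits.
\<close>

lemma Bessel_product_bound:
  assumes e: "orthonormal_family I e" and I: "finite I"
  shows "(\<Sum>i\<in>I. cmod (cinner \<psi> (e i)) * cmod (cinner (e i) \<phi>)) \<le> norm \<psi> * norm \<phi>"
proof -
  have cm: "cmod (cinner (e i) \<phi>) = cmod (cinner \<phi> (e i))" for i
    by (subst cinner_commute) simp
  have "(\<Sum>i\<in>I. \<bar>cmod (cinner \<psi> (e i))\<bar> * \<bar>cmod (cinner \<phi> (e i))\<bar>)
      \<le> L2_set (\<lambda>i. cmod (cinner \<psi> (e i))) I * L2_set (\<lambda>i. cmod (cinner \<phi> (e i))) I"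
    by (rule L2_set_mult_ineq)
  also have "\<dots> \<le> norm \<psi> * norm \<phi>"
    unfolding L2_set_def
    by (intro mult_mono real_le_lsqrt sum_nonneg Bessel_inequality[OF e I]) (auto intro: sum_nonneg)
  finally show ?thesis by (simp add: cm)
qed

text \<open>
  Separability in the weak form that is needed: only the zero vector is orthogonal to all of \<open>D\<close>.
  The set \<open>D\<close> consists of indicators of finite intersections of members of a countable topological
  basis, cut off to balls of integer radius to make them square integrable. A function orthogonal to
  \<open>D\<close> integrates to zero over a \<open>\<pi>\<close>-system generating the Borel sets, hence over every
  Borel subset of each ball, hence vanishes almost everywhere.
\<close>

lemma countable_separating_l2:
  "\<exists>D::'a::euclidean_space l2 set. countable D \<and> (\<forall>\<psi>. (\<forall>\<xi>\<in>D. cinner \<psi> \<xi> = 0) \<longrightarrow> \<psi> = 0)"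
proof -
  obtain B :: "'a set set" where B: "countable B" "topological_basis B"
    using ex_countable_basis by blast
  define G where "G = Inter ` {F. finite F \<and> F \<subseteq> B}"
  have G_count: "countable G"
    unfolding G_def by (intro countable_image countable_Collect_finite_subset B)
  have G_stable: "Int_stable G"
  proof (rule Int_stableI)
    fix a b assume "a \<in> G" "b \<in> G"
    then obtain F F' where "finite F" "F \<subseteq> B" "a = \<Inter>F" "finite F'" "F' \<subseteq> B" "b = \<Inter>F'"
      unfolding G_def by blast
    then have "a \<inter> b = \<Inter>(F \<union> F')" "finite (F \<union> F')" "F \<union> F' \<subseteq> B" by auto
    then show "a \<inter> b \<in> G" unfolding G_def by blast
  qed
  have "UNIV = \<Inter>({} :: 'a set set)" by simp
  then have UNIV_G: "UNIV \<in> G" unfolding G_def by blast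
  have "B \<subseteq> G"
  proof
    fix b assume "b \<in> B"
    then have "b = \<Inter>{b}" "finite {b}" "{b} \<subseteq> B" by auto
    then show "b \<in> G" unfolding G_def by blast
  qed
  then have G_gen: "A \<in> sigma_sets UNIV G" if "A \<in> sets borel" for A
    using that unfolding borel_eq_countable_basis[OF B] by (auto intro: sigma_sets_mono'[THEN subsetD])
  have G_borel: "A \<in> sets borel" if A: "A \<in> G" for A
  proof -
    obtain F where F: "finite F" "F \<subseteq> B" "A = \<Inter>F" using A unfolding G_def by blast
    then have "open A" using topological_basis_open[OF B(2)] by (auto intro!: open_Inter)
    then show ?thesis by simp
  qed
  have sg: "sigma_sets UNIV G = sets borel"
    using G_gen sets.sigma_sets_subset[of G borel] G_borel by auto
  define k where "k A n t = (indicator (A \<inter> ball 0 (real n)) t :: complex)" for A n and t :: 'a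
  have k: "square_integrable (k A n)" if [measurable]: "A \<in> sets borel" for A n
  proof -
    have "bounded (A \<inter> ball 0 (real n))"
      by (rule bounded_subset[OF bounded_ball]) auto
    then have "emeasure lborel (A \<inter> ball 0 (real n)) < \<infinity>"
      by (rule emeasure_bounded_finite)
    then have "integrable lborel (indicator (A \<inter> ball 0 (real n)) :: 'a \<Rightarrow> real)"
      by (intro integrable_real_indicator) auto
    moreover have "k A n \<in> borel_measurable borel"
      unfolding k_def[abs_def] by (intro borel_measurable_indicator) auto
    moreover have "(cmod (k A n t))\<^sup>2 = indicator (A \<inter> ball 0 (real n)) t" for t
      by (simp add: k_def indicator_def)
    ultimately show ?thesis
      unfolding square_integrable_def by simp
  qed
  have cnj_k: "cnj (k A n t) = k A n t" for A n t by (simp add: k_def indicator_def)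
  define D where "D = (\<lambda>(A, n). abs_l2 (k A n)) ` (G \<times> UNIV)"
  have "countable D"
    unfolding D_def by (intro countable_image countable_SIGMA G_count) auto
  moreover have "\<psi> = 0" if *: "\<forall>\<xi>\<in>D. cinner \<psi> \<xi> = 0" for \<psi>
  proof -
    obtain f where f: "square_integrable f" "\<psi> = abs_l2 f"
      using l2_representative by blast
    note [measurable] = square_integrable_measurable[OF f(1)]
    have "AE t in lborel. f t * indicator (ball 0 (real n)) t = 0" for n
    proof (rule sigma_finite_measure.density_zero[OF sigma_finite_lborel])
      let ?g = "\<lambda>t. f t * indicator (ball 0 (real n)) t"
      show int: "integrable lborel ?g"
        using square_integrable_mult_cnj[OF f(1) k[of UNIV n]] unfolding cnj_k by (simp add: k_def)
      have G_zero: "set_lebesgue_integral lborel A ?g = 0" if A: "A \<in> G" for A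
      proof -
        have "cinner \<psi> (abs_l2 (k A n)) = 0"
          using * A unfolding D_def by force
        also have "cinner \<psi> (abs_l2 (k A n)) = (\<integral>t. f t * cnj (k A n t) \<partial>lborel)"
          unfolding f(2) by (rule cinner.abs_eq) (simp_all add: l2_rel_def f(1) k G_borel[OF A])
        also have "\<dots> = set_lebesgue_integral lborel A ?g"
          unfolding set_lebesgue_integral_def cnj_k
          by (intro Bochner_Integration.integral_cong) (auto simp: k_def indicator_def)
        finally show ?thesis by simp
      qed
      have si: "set_integrable lborel A ?g" if "A \<in> sets borel" for A
        unfolding set_integrable_def using that int by (intro integrable_mult_indicator) auto
      fix A :: "'a set" assume "A \<in> sets lborel"
      then have A: "A \<in> sigma_sets UNIV G" using G_gen by simp
      have "G \<subseteq> Pow UNIV" by simp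
      from G_stable this A show "set_lebesgue_integral lborel A ?g = 0"
      proof (induction rule: sigma_sets_induct_disjoint)
        case (basic A) then show ?case by (rule G_zero)
      next
        case empty then show ?case by (simp add: set_lebesgue_integral_def)
      next
        case (compl A)
        have "set_lebesgue_integral lborel (A \<union> (UNIV - A)) ?g
            = set_lebesgue_integral lborel A ?g + set_lebesgue_integral lborel (UNIV - A) ?g"
          using compl(1) unfolding sg by (intro set_integral_Un si) auto
        then show ?case using compl(2) G_zero[OF UNIV_G] by simp
      next
        case (union A)
        have "set_lebesgue_integral lborel (\<Union>i. A i) ?g = (\<Sum>i. set_lebesgue_integral lborel (A i) ?g)"
          using union(1,2) unfolding sg
          by (intro lebesgue_integral_countable_add si) (auto simp: disjoint_family_on_def)
        then show ?case using union(3) by simp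
      qed
    qed
    then have "AE t in lborel. \<forall>n::nat. f t * indicator (ball 0 (real n)) t = 0"
      unfolding AE_all_countable by (rule allI)
    then have "AE t in lborel. f t = 0"
    proof eventually_elim
      fix t :: 'a assume z: "\<forall>n::nat. f t * indicator (ball 0 (real n)) t = 0"
      obtain n where "norm t < real n" using reals_Archimedean2 by blast
      then show "f t = 0" using z[rule_format, of n] by simp
    qed
    then have "l2_rel f (\<lambda>t. 0)"
      using f(1) by (simp add: l2_rel_def square_integrable_zero)
    then show "\<psi> = 0"
      unfolding f(2) zero_l2_def by (rule Quotient_rel_abs[OF Quotient_l2])
  qed
  ultimately show ?thesis by blast
qed

lemma is_onb_norm:
  assumes "is_onb E" "x \<in> E" shows "norm x = 1"
proof -
  have "complex_of_real ((norm x)\<^sup>2) = of_real 1"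
    using assms unfolding is_onb_def cinner_self[symmetric] by simp
  then have "(norm x)\<^sup>2 = 1" by (simp only: of_real_eq_iff)
  then show ?thesis using power2_eq_1_iff[of "norm x"] norm_ge_zero[of x] by linarith
qed

text \<open>
  By Bessel's inequality each of the countably many separating vectors is orthogonal to all but
  countably many members of the basis, and no member is orthogonal to all separating vectors.
\<close>

lemma countable_onb:
  assumes E: "is_onb E" shows "countable E"
proof -
  obtain D :: "'a l2 set" where D: "countable D" "\<And>\<psi>. (\<forall>\<xi>\<in>D. cinner \<psi> \<xi> = 0) \<Longrightarrow> \<psi> = 0"
    using countable_separating_l2 by blast
  have on: "orthonormal_family E (\<lambda>e. e)"
    using E is_onb_norm[OF E] unfolding orthonormal_family_def is_onb_def by metis
  have "countable {e \<in> E. (cmod (cinner \<xi> e))\<^sup>2 \<noteq> 0}" for \<xi>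
  proof (rule summable_countable_real, rule nonneg_bdd_above_summable_on)
    show "bdd_above (sum (\<lambda>e. (cmod (cinner \<xi> e))\<^sup>2) ` {F. F \<subseteq> E \<and> finite F})"
      by (rule bdd_aboveI2[where M = "(norm \<xi>)\<^sup>2"])
         (auto intro: Bessel_inequality orthonormal_family_mono[OF on])
  qed simp
  then have "countable (\<Union>\<xi>\<in>D. {e \<in> E. (cmod (cinner \<xi> e))\<^sup>2 \<noteq> 0})"
    using D(1) by (intro countable_UN) auto
  moreover have "E \<subseteq> (\<Union>\<xi>\<in>D. {e \<in> E. (cmod (cinner \<xi> e))\<^sup>2 \<noteq> 0})"
  proof
    fix e assume e: "e \<in> E"
    then have "e \<noteq> 0" using is_onb_norm[OF E] by force
    then obtain \<xi> where "\<xi> \<in> D" "cinner e \<xi> \<noteq> 0" using D(2) by blast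
    then show "e \<in> (\<Union>\<xi>\<in>D. {e \<in> E. (cmod (cinner \<xi> e))\<^sup>2 \<noteq> 0})"
      using e cinner_commute[of e \<xi>] by auto
  qed
  ultimately show ?thesis by (rule countable_subset[rotated])
qed

text \<open>
  A sequential version of an orthonormal basis; the zero vectors contribute nothing to any of the sums
  over a basis.
\<close>

definition onb_seq :: "(nat \<Rightarrow> 'a::euclidean_space l2) \<Rightarrow> bool" where
  "onb_seq e \<longleftrightarrow> orthonormal_family UNIV e \<and> (\<forall>\<psi>. (\<forall>n. cinner \<psi> (e n) = 0) \<longrightarrow> \<psi> = 0)"

lemma onb_seq_orthonormal: "onb_seq e \<Longrightarrow> orthonormal_family I e"
  by (auto simp: onb_seq_def intro: orthonormal_family_mono)

text \<open>
  The trace is an unordered sum over a set of vectors, whereas dominated convergence is about sequences.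
  The enumeration fills the indices outside the range of an injection into the natural numbers with
  zero, which is why only summands with \<open>g 0 = 0\<close> can be transferred.
\<close>

lemma onb_enumeration:
  fixes E :: "'a::euclidean_space l2 set"
  assumes E: "is_onb E"
  shows "\<exists>e. onb_seq e \<and> (\<forall>(g::'a l2 \<Rightarrow> complex) x.
    g 0 = 0 \<longrightarrow> (g has_sum x) E \<longleftrightarrow> ((\<lambda>n. g (e n)) has_sum x) UNIV)"
proof -
  define h where "h = to_nat_on E"
  have h: "inj_on h E" unfolding h_def by (rule inj_on_to_nat_on[OF countable_onb[OF E]])
  define e where "e n = (if n \<in> h ` E then inv_into E h n else 0)" for n
  have eh: "e (h x) = x" if "x \<in> E" for x using h that by (simp add: e_def)
  have e0: "e n = 0" if "n \<notin> h ` E" for n using that by (simp add: e_def)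
  have eE: "e n = 0 \<or> e n \<in> E" for n by (auto simp: e_def inv_into_into)
  have "cinner (e i) (e j) = 0" if "i \<noteq> j" for i j
  proof (cases "i \<in> h ` E \<and> j \<in> h ` E")
    case True
    then obtain x y where "x \<in> E" "y \<in> E" "i = h x" "j = h y" by blast
    then show ?thesis using E that eh unfolding is_onb_def by metis
  qed (auto simp: e0)
  moreover have "e n = 0 \<or> norm (e n) = 1" for n using eE is_onb_norm[OF E] by blast
  moreover have "\<psi> = 0" if "\<forall>n. cinner \<psi> (e n) = 0" for \<psi>
    using E that eh unfolding is_onb_def by metis
  ultimately have "onb_seq e"
    unfolding onb_seq_def orthonormal_family_def by blast
  moreover have "(g has_sum x) E \<longleftrightarrow> ((\<lambda>n. g (e n)) has_sum x) UNIV"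
    if g0: "g 0 = 0" for g :: "_ \<Rightarrow> complex" and x
  proof -
    have "((\<lambda>n. g (e n)) has_sum x) UNIV \<longleftrightarrow> ((\<lambda>n. g (e n)) has_sum x) (h ` E)"
      by (rule has_sum_cong_neutral) (auto simp: e0 g0)
    also have "\<dots> \<longleftrightarrow> (((\<lambda>n. g (e n)) \<circ> h) has_sum x) E"
      by (rule has_sum_reindex[OF h])
    also have "\<dots> \<longleftrightarrow> (g has_sum x) E"
      by (rule has_sum_cong) (simp add: eh)
    finally show ?thesis by simp
  qed
  ultimately show ?thesis by blast
qed

lemma summable_orthonormal:
  assumes e: "orthonormal_family UNIV e" and c: "summable (\<lambda>n. (cmod (c n))\<^sup>2)"
  shows "summable (\<lambda>n. scaleC (c n) (e n))"
  unfolding summable_Cauchy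
proof (intro allI impI)
  fix \<epsilon> :: real assume \<epsilon>: "\<epsilon> > 0"
  then obtain N where N: "\<And>m n. m \<ge> N \<Longrightarrow> norm (\<Sum>i\<in>{m..<n}. (cmod (c i))\<^sup>2) < \<epsilon>\<^sup>2"
    using c unfolding summable_Cauchy by (meson zero_less_power)
  have "norm (\<Sum>i\<in>{m..<n}. scaleC (c i) (e i)) < \<epsilon>" if "m \<ge> N" for m n
  proof -
    have "(norm (\<Sum>i\<in>{m..<n}. scaleC (c i) (e i)))\<^sup>2 \<le> (\<Sum>i\<in>{m..<n}. (cmod (c i))\<^sup>2)"
      by (intro norm_orthonormal_sum_le orthonormal_family_mono[OF e]) auto
    also have "\<dots> < \<epsilon>\<^sup>2" using N[OF that, of n] by simp
    finally show ?thesis using \<epsilon> by (rule power_less_imp_less_base[OF _ less_imp_le])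
  qed
  then show "\<exists>N. \<forall>m\<ge>N. \<forall>n. norm (\<Sum>i\<in>{m..<n}. scaleC (c i) (e i)) < \<epsilon>" by blast
qed

text \<open>
  The series converges by Bessel's inequality and completeness; its sum has the same coefficients as
  \<open>\<psi>\<close>, and a vector without coefficients is zero.
\<close>

lemma onb_expansion:
  assumes e: "onb_seq e"
  shows "(\<lambda>n. scaleC (cinner \<psi> (e n)) (e n)) sums \<psi>"
proof -
  note on = onb_seq_orthonormal[OF e]
  let ?f = "\<lambda>n. scaleC (cinner \<psi> (e n)) (e n)"
  have "summable (\<lambda>n. (cmod (cinner \<psi> (e n)))\<^sup>2)"
    by (rule bounded_imp_summable[where B = "(norm \<psi>)\<^sup>2"]) (auto intro: Bessel_inequality[OF on])
  then have "summable ?f" by (rule summable_orthonormal[OF on])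
  then have sums: "?f sums suminf ?f" by (rule summable_sums)
  have "cinner (\<psi> - suminf ?f) (e m) = 0" for m
  proof -
    have "(\<lambda>N. cinner (\<Sum>n<N. ?f n) (e m)) \<longlonglongrightarrow> cinner (suminf ?f) (e m)"
      using sums unfolding sums_def by (rule tendsto_cinner)
    moreover have "eventually (\<lambda>N. cinner (\<Sum>n<N. ?f n) (e m) = cinner \<psi> (e m)) sequentially"
      using eventually_gt_at_top[of m]
    proof eventually_elim
      case (elim N)
      have "e m = 0 \<or> norm (e m) = 1" using on[of UNIV] by (auto simp: orthonormal_family_def)
      then show ?case using elim by (auto simp: cinner_orthonormal_sum[OF on])
    qed
    then have "(\<lambda>N. cinner (\<Sum>n<N. ?f n) (e m)) \<longlonglongrightarrow> cinner \<psi> (e m)"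
      by (rule tendsto_eventually)
    ultimately have "cinner (suminf ?f) (e m) = cinner \<psi> (e m)"
      by (rule LIMSEQ_unique)
    then show ?thesis by (simp add: cinner_diff_left)
  qed
  then have "\<psi> - suminf ?f = 0" using e unfolding onb_seq_def by blast
  with sums show ?thesis by simp
qed

lemma Parseval_identity:
  assumes e: "onb_seq e"
  shows "(\<lambda>n. cinner \<psi> (e n) * cinner (e n) \<phi>) sums cinner \<psi> \<phi>"
  using tendsto_cinner[OF onb_expansion[OF e, of \<psi>, unfolded sums_def], of \<phi>]
  by (simp add: sums_def cinner_sum_left cinner_scaleC_left)

section \<open>Riesz representation and adjoints\<close>

text \<open>
  The representing vector is given by its expected coefficients \<open>cnj (L (e n))\<close>. They are square
  summable, since testing \<open>L\<close> on the partial sums \<open>w\<close> of that very series gives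
  \<open>s = L w \<le> C * norm w \<le> C * sqrt s\<close> for the partial sums \<open>s\<close> of their squares.
\<close>

lemma Riesz_representation:
  fixes L :: "'a::euclidean_space l2 \<Rightarrow> complex"
  assumes e: "onb_seq (e :: nat \<Rightarrow> 'a l2)"
    and add: "\<And>\<psi> \<phi>. L (\<psi> + \<phi>) = L \<psi> + L \<phi>" and scale: "\<And>c \<psi>. L (scaleC c \<psi>) = c * L \<psi>"
    and bound: "\<And>\<psi>. cmod (L \<psi>) \<le> C * norm \<psi>"
  shows "\<exists>v. \<forall>\<psi>. L \<psi> = cinner \<psi> v"
proof -
  note on = onb_seq_orthonormal[OF e]
  have L0: "L 0 = 0" using add[of 0 0] by simp
  have L_sum: "L (\<Sum>i\<in>I. scaleC (c i) (e i)) = (\<Sum>i\<in>I. c i * L (e i))" for c and I :: "nat set"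
    by (induction I rule: infinite_finite_induct) (auto simp: L0 add scale)
  have "(\<Sum>n<N. (cmod (cnj (L (e n))))\<^sup>2) \<le> C\<^sup>2" for N
  proof -
    define s where "s = (\<Sum>n<N. (cmod (cnj (L (e n))))\<^sup>2)"
    define w where "w = (\<Sum>n<N. scaleC (cnj (L (e n))) (e n))"
    have s0: "s \<ge> 0" unfolding s_def by (intro sum_nonneg) simp
    have "L w = of_real s"
      unfolding w_def s_def L_sum of_real_sum complex_norm_square by simp
    then have "s \<le> C * norm w" using bound[of w] s0 by simp
    then have "s\<^sup>2 \<le> C\<^sup>2 * (norm w)\<^sup>2"
      using power_mono[of s "C * norm w" 2] s0 by (simp add: power_mult_distrib)
    also have "\<dots> \<le> C\<^sup>2 * s"
      unfolding w_def s_def by (intro mult_left_mono norm_orthonormal_sum_le on) auto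
    finally have "s * s \<le> C\<^sup>2 * s" by (simp add: power2_eq_square)
    then show ?thesis
      unfolding s_def[symmetric] using s0 by (cases "s = 0") auto
  qed
  then have "summable (\<lambda>n. (cmod (cnj (L (e n))))\<^sup>2)"
    by (intro bounded_imp_summable[where B = "C\<^sup>2"]) (simp_all only: lessThan_Suc_atMost[symmetric] zero_le_power2)
  from summable_orthonormal[OF on this]
  obtain v where v: "(\<lambda>n. scaleC (cnj (L (e n))) (e n)) sums v"
    unfolding summable_def by blast
  have "L \<psi> = cinner \<psi> v" for \<psi>
  proof -
    let ?p = "\<lambda>N. \<Sum>n<N. scaleC (cinner \<psi> (e n)) (e n)"
    have "(\<lambda>N. cnj (cinner (\<Sum>n<N. scaleC (cnj (L (e n))) (e n)) \<psi>)) \<longlonglongrightarrow> cnj (cinner v \<psi>)"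
      using v unfolding sums_def by (intro tendsto_cnj tendsto_cinner)
    moreover have "cnj (cinner (\<Sum>n<N. scaleC (cnj (L (e n))) (e n)) \<psi>) = L (?p N)" for N
      unfolding L_sum cinner_sum_left cinner_scaleC_left cnj_sum
      by (intro sum.cong refl) (simp add: cinner_commute[of "e _" \<psi>])
    ultimately have lim1: "(\<lambda>N. L (?p N)) \<longlonglongrightarrow> cinner \<psi> v"
      by (simp flip: cinner_commute)
    have diff: "L \<phi> - L \<psi> = L (\<phi> - \<psi>)" for \<phi> using add[of "\<phi> - \<psi>" \<psi>] by simp
    have lim2: "(\<lambda>N. L (?p N)) \<longlonglongrightarrow> L \<psi>"
    proof (rule Lim_null_comparison[THEN LIM_zero_cancel])
      show "\<forall>\<^sub>F N in sequentially. norm (L (?p N) - L \<psi>) \<le> C * norm (?p N - \<psi>)"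
        by (simp add: diff bound)
      show "(\<lambda>N. C * norm (?p N - \<psi>)) \<longlonglongrightarrow> 0"
        using onb_expansion[OF e, of \<psi>] unfolding sums_def
        by (intro tendsto_mult_right_zero tendsto_norm_zero LIM_zero)
    qed
    show ?thesis using LIMSEQ_unique[OF lim2 lim1] .
  qed
  then show ?thesis by blast
qed

lemma adj_eqI:
  assumes "\<And>\<psi> \<phi>. cinner (T \<psi>) \<phi> = cinner \<psi> (B \<phi>)"
  shows "adj T = B"
  unfolding adj_def
proof (rule the_equality)
  show "\<forall>\<psi> \<phi>. cinner (T \<psi>) \<phi> = cinner \<psi> (B \<phi>)" using assms by blast
  fix B' assume B': "\<forall>\<psi> \<phi>. cinner (T \<psi>) \<phi> = cinner \<psi> (B' \<phi>)"
  show "B' = B"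
  proof
    fix \<phi> show "B' \<phi> = B \<phi>" by (rule cinner_ext_right) (metis assms B')
  qed
qed

text \<open>
  Riesz representation guarantees that the description defining \<^const>\<open>adj\<close> denotes an operator.
\<close>

lemma cinner_adj:
  assumes e: "onb_seq (e :: nat \<Rightarrow> 'a::euclidean_space l2)" and T: "bounded_op (T :: 'a l2 \<Rightarrow> 'a l2)"
  shows "cinner (T \<psi>) \<phi> = cinner \<psi> (adj T \<phi>)"
proof -
  interpret bounded_linear T using T by (simp add: bounded_op_def)
  obtain K where K: "\<And>\<psi>. norm (T \<psi>) \<le> norm \<psi> * K" using bounded by blast
  have "\<exists>v. \<forall>\<psi>. cinner (T \<psi>) \<phi> = cinner \<psi> v" for \<phi>
  proof (rule Riesz_representation[OF e])
    show "cinner (T (\<psi> + \<psi>')) \<phi> = cinner (T \<psi>) \<phi> + cinner (T \<psi>') \<phi>" for \<psi> \<psi>'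
      by (simp add: add cinner_add_left)
    show "cinner (T (scaleC c \<psi>)) \<phi> = c * cinner (T \<psi>) \<phi>" for c \<psi>
      using T by (simp add: bounded_op_def cinner_scaleC_left)
    show "cmod (cinner (T \<psi>) \<phi>) \<le> (K * norm \<phi>) * norm \<psi>" for \<psi>
      using cinner_Cauchy_Schwarz[of "T \<psi>" \<phi>] mult_right_mono[OF K[of \<psi>] norm_ge_zero[of \<phi>]]
      by (simp add: mult_ac)
  qed
  then obtain B where B: "\<And>\<psi> \<phi>. cinner (T \<psi>) \<phi> = cinner \<psi> (B \<phi>)" by metis
  then have "adj T = B" by (rule adj_eqI)
  with B show ?thesis by simp
qed

section \<open>Trace-class operators are nuclear\<close>

text \<open>
  Positivity without boundedness. The operators produced by the elimination below satisfy this by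
  purely algebraic arguments, and a bound for them comes for free from domination by the original one.
\<close>

definition positive_hermitian :: "('a::euclidean_space l2 \<Rightarrow> 'a l2) \<Rightarrow> bool" where
  "positive_hermitian Q \<longleftrightarrow>
     (\<forall>\<psi> \<phi>. Q (\<psi> + \<phi>) = Q \<psi> + Q \<phi>) \<and> (\<forall>c \<psi>. Q (scaleC c \<psi>) = scaleC c (Q \<psi>)) \<and>
     (\<forall>\<psi> \<phi>. cinner (Q \<psi>) \<phi> = cnj (cinner (Q \<phi>) \<psi>)) \<and> (\<forall>\<psi>. Re (cinner (Q \<psi>) \<psi>) \<ge> 0)"

lemma positive_hermitianD:
  assumes "positive_hermitian Q"
  shows "Q (\<psi> + \<phi>) = Q \<psi> + Q \<phi>" "Q (scaleC c \<psi>) = scaleC c (Q \<psi>)"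
    "cinner (Q \<psi>) \<phi> = cnj (cinner (Q \<phi>) \<psi>)" "Re (cinner (Q \<psi>) \<psi>) \<ge> 0"
    "Q (\<psi> - \<phi>) = Q \<psi> - Q \<phi>"
    "cinner (Q \<psi>) \<psi> = of_real (Re (cinner (Q \<psi>) \<psi>))"
    "cinner (Q \<psi>) \<phi> = cinner \<psi> (Q \<phi>)"
proof -
  show 1: "Q (\<psi> + \<phi>) = Q \<psi> + Q \<phi>" for \<psi> \<phi> using assms unfolding positive_hermitian_def by blast
  show "Q (scaleC c \<psi>) = scaleC c (Q \<psi>)" using assms unfolding positive_hermitian_def by blast
  show 2: "cinner (Q \<psi>) \<phi> = cnj (cinner (Q \<phi>) \<psi>)" for \<psi> \<phi>
    using assms unfolding positive_hermitian_def by blast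
  show "Re (cinner (Q \<psi>) \<psi>) \<ge> 0" using assms unfolding positive_hermitian_def by blast
  show "Q (\<psi> - \<phi>) = Q \<psi> - Q \<phi>" using 1[of "\<psi> - \<phi>" \<phi>] by simp
  show "cinner (Q \<psi>) \<psi> = of_real (Re (cinner (Q \<psi>) \<psi>))"
    using arg_cong[OF 2[of \<psi> \<psi>], of Im] by (simp add: complex_eq_iff)
  show "cinner (Q \<psi>) \<phi> = cinner \<psi> (Q \<phi>)"
    by (metis 2 cinner_commute)
qed

text \<open>
  Polarisation: a form that is real on the diagonal is Hermitian.
\<close>

lemma positive_hermitian_positive_op:
  assumes P: "positive_op P" shows "positive_hermitian P"
proof -
  have lin: "P (\<psi> + \<phi>) = P \<psi> + P \<phi>" "P (scaleC c \<psi>) = scaleC c (P \<psi>)" for \<psi> \<phi> c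
    using P unfolding positive_op_def bounded_op_def by (auto simp: linear_simps)
  have q: "Im (cinner (P \<psi>) \<psi>) = 0" "Re (cinner (P \<psi>) \<psi>) \<ge> 0" for \<psi>
    using P unfolding positive_op_def by (auto simp: complex_nonneg_Reals_iff)
  have "cinner (P \<psi>) \<phi> = cnj (cinner (P \<phi>) \<psi>)" for \<psi> \<phi>
  proof -
    have "Im (cinner (P \<psi>) \<phi>) + Im (cinner (P \<phi>) \<psi>) = 0"
      using q(1)[of "\<psi> + \<phi>"] q(1)[of \<psi>] q(1)[of \<phi>]
      by (simp add: lin cinner_add_left cinner_add_right)
    moreover have "Re (cinner (P \<phi>) \<psi>) - Re (cinner (P \<psi>) \<phi>) = 0"
      using q(1)[of "\<psi> + scaleC \<i> \<phi>"] q(1)[of \<psi>] q(1)[of \<phi>]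
      by (simp add: lin cinner_add_left cinner_add_right cinner_scaleC_left cinner_scaleC_right)
    ultimately show ?thesis by (simp add: complex_eq_iff)
  qed
  then show ?thesis
    unfolding positive_hermitian_def using lin q(2) by blast
qed

text \<open>
  Evaluate the nonnegative form at \<open>\<psi> - t Q \<psi>\<close> with the optimal \<open>t = 1 / K\<close>. The point is
  that \<open>K\<close> bounds the form only, so that the same constant serves for all operators below a given one.
\<close>

lemma norm_positive_hermitian:
  assumes Q: "positive_hermitian Q" and K: "K > 0"
    and bound: "\<And>\<psi>. Re (cinner (Q \<psi>) \<psi>) \<le> K * (norm \<psi>)\<^sup>2"
  shows "(norm (Q \<psi>))\<^sup>2 \<le> K * Re (cinner (Q \<psi>) \<psi>)"
proof -
  note QD = positive_hermitianD[OF Q]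
  define t where "t = complex_of_real (1 / K)"
  define N where "N = (norm (Q \<psi>))\<^sup>2"
  have c1: "cinner (Q \<psi>) (Q \<psi>) = of_real N" by (simp add: N_def cinner_self)
  have c2: "cinner (Q (Q \<psi>)) \<psi> = of_real N" using c1 QD(7)[of "Q \<psi>" \<psi>] by simp
  have "0 \<le> Re (cinner (Q (\<psi> - scaleC t (Q \<psi>))) (\<psi> - scaleC t (Q \<psi>)))" by (rule QD)
  also have "\<dots> = Re (cinner (Q \<psi>) \<psi>) - 2 * (1 / K) * N + (1 / K)\<^sup>2 * Re (cinner (Q (Q \<psi>)) (Q \<psi>))"
    unfolding QD(5) QD(2) cinner_diff_left cinner_diff_right cinner_scaleC_left cinner_scaleC_right c1 c2
    using K by (simp add: t_def power2_eq_square field_simps)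
  also have "\<dots> \<le> Re (cinner (Q \<psi>) \<psi>) - 2 * (1 / K) * N + (1 / K)\<^sup>2 * (K * N)"
    using bound[of "Q \<psi>"] by (intro add_left_mono mult_left_mono) (auto simp: N_def)
  also have "\<dots> = Re (cinner (Q \<psi>) \<psi>) - N / K"
    using K by (simp add: power2_eq_square field_simps)
  finally show ?thesis using K by (simp add: N_def field_simps)
qed

text \<open>
  The Schur complement of \<open>Q\<close> with respect to the vector \<open>e\<close>, that is, one step of Cholesky
  elimination: a rank-one operator is subtracted so that \<open>e\<close> lies in the kernel of the result. If
  \<open>cinner (Q e) e = 0\<close> the quotient is zero by convention and nothing is subtracted; for positive \<open>Q\<close>
  of bounded form \<open>e\<close> is then in the kernel already.
\<close>

definition schur_step :: "'a::euclidean_space l2 \<Rightarrow> ('a l2 \<Rightarrow> 'a l2) \<Rightarrow> 'a l2 \<Rightarrow> 'a l2" where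
  "schur_step e Q \<psi> = Q \<psi> - scaleC (cinner (Q \<psi>) e / cinner (Q e) e) (Q e)"

lemma schur_step_form:
  assumes Q: "positive_hermitian Q"
  shows "Re (cinner (schur_step e Q \<psi>) \<psi>)
       = Re (cinner (Q \<psi>) \<psi>) - (cmod (cinner (Q \<psi>) e))\<^sup>2 / Re (cinner (Q e) e)"
proof -
  note QD = positive_hermitianD[OF Q]
  have "cinner (schur_step e Q \<psi>) \<psi>
      = cinner (Q \<psi>) \<psi> - cinner (Q \<psi>) e * cnj (cinner (Q \<psi>) e) / of_real (Re (cinner (Q e) e))"
    unfolding schur_step_def cinner_diff_left cinner_scaleC_left
    by (subst QD(3)[of e \<psi>], subst QD(6)[of e]) simp
  then show ?thesis
    by (simp only: complex_norm_square[symmetric] of_real_divide[symmetric] minus_complex.sel Re_complex_of_real)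
qed

text \<open>
  Positivity is preserved because the new form at \<open>\<psi>\<close> is the old form at \<open>\<psi> - c e\<close>, where
  \<open>c\<close> is the coefficient of the projection of \<open>\<psi>\<close> onto \<open>e\<close> with respect to the old form.
\<close>

lemma positive_hermitian_schur_step:
  assumes Q: "positive_hermitian Q" shows "positive_hermitian (schur_step e Q)"
  unfolding positive_hermitian_def
proof (intro conjI allI)
  note QD = positive_hermitianD[OF Q]
  define d where "d = Re (cinner (Q e) e)"
  have d: "cinner (Q e) e = of_real d" unfolding d_def by (rule QD(6))
  fix \<psi> \<phi> c
  show "schur_step e Q (\<psi> + \<phi>) = schur_step e Q \<psi> + schur_step e Q \<phi>"
    by (rule cinner_ext_left)
       (simp add: schur_step_def QD(1,2) cinner_add_left cinner_diff_left cinner_scaleC_left algebra_simps add_divide_distrib)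
  show "schur_step e Q (scaleC c \<psi>) = scaleC c (schur_step e Q \<psi>)"
    by (rule cinner_ext_left)
       (simp add: schur_step_def QD(1,2) cinner_add_left cinner_diff_left cinner_scaleC_left algebra_simps)
  show "cinner (schur_step e Q \<psi>) \<phi> = cnj (cinner (schur_step e Q \<phi>) \<psi>)"
    unfolding schur_step_def cinner_diff_left cinner_scaleC_left d
    using QD(3)[of \<psi> \<phi>] QD(3)[of e \<psi>] QD(3)[of e \<phi>] by simp
  show "Re (cinner (schur_step e Q \<psi>) \<psi>) \<ge> 0"
  proof (cases "d = 0")
    case True
    then show ?thesis by (simp add: schur_step_def d QD(4))
  next
    case False
    define z where "z = cinner (Q \<psi>) e"
    define c where "c = z / of_real d"
    have e\<psi>: "cinner (Q e) \<psi> = cnj z" unfolding z_def by (rule QD(3))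
    have "0 \<le> Re (cinner (Q (\<psi> - scaleC c e)) (\<psi> - scaleC c e))" by (rule QD)
    also have "cinner (Q (\<psi> - scaleC c e)) (\<psi> - scaleC c e) = cinner (Q \<psi>) \<psi> - z * cnj z / of_real d"
      unfolding QD(5) QD(2) cinner_diff_left cinner_diff_right cinner_scaleC_left cinner_scaleC_right e\<psi> d
        z_def[symmetric]
      using False by (simp add: c_def field_simps)
    also have "\<dots> = cinner (schur_step e Q \<psi>) \<psi>"
      by (simp add: schur_step_def cinner_diff_left cinner_scaleC_left d e\<psi> z_def[symmetric])
    finally show ?thesis .
  qed
qed

text \<open>
  The elimination carried out on vectors instead of operators: after eliminating \<open>e 0\<close>, \<dots>,
  \<open>e (n - 1)\<close> from \<open>P\<close>, what is left of \<open>P \<psi>\<close> is \<open>P (residual P e n \<psi>)\<close>. Keeping track of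
  the preimages makes it possible to apply another operator than \<open>P\<close> to them.
\<close>

primrec residual :: "('a::euclidean_space l2 \<Rightarrow> 'a l2) \<Rightarrow> (nat \<Rightarrow> 'a l2) \<Rightarrow> nat \<Rightarrow> 'a l2 \<Rightarrow> 'a l2" where
  "residual P e 0 \<psi> = \<psi>"
| "residual P e (Suc n) \<psi> = residual P e n \<psi> -
     scaleC (cinner (P (residual P e n \<psi>)) (e n) / cinner (P (residual P e n (e n))) (e n))
       (residual P e n (e n))"

lemma P_residual_Suc:
  assumes P: "positive_hermitian P"
  shows "P (residual P e (Suc n) \<psi>) = schur_step (e n) (\<lambda>\<psi>. P (residual P e n \<psi>)) \<psi>"
  by (simp add: schur_step_def positive_hermitianD(2,5)[OF P])

lemma positive_hermitian_residual:
  assumes P: "positive_hermitian P"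
  shows "positive_hermitian (\<lambda>\<psi>. P (residual P e n \<psi>))"
proof (induction n)
  case (Suc n)
  from positive_hermitian_schur_step[OF Suc, of "e n"] show ?case
    by (simp add: P_residual_Suc[OF P] del: residual.simps(2))
qed (simp add: P)

text \<open>
  Each step lowers the form by the square of one coefficient. Since the remaining form is nonnegative,
  these squares are summable with sum at most the value of the form of \<open>P\<close>, which is the analogue of
  Bessel's inequality for the form of \<open>P\<close>.
\<close>

lemma residual_form:
  assumes P: "positive_hermitian P"
  shows "Re (cinner (P (residual P e n \<psi>)) \<psi>) = Re (cinner (P \<psi>) \<psi>) -
    (\<Sum>k<n. (cmod (cinner (P (residual P e k \<psi>)) (e k)))\<^sup>2 / Re (cinner (P (residual P e k (e k))) (e k)))"
proof (induction n)
  case (Suc n)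
  show ?case
    unfolding P_residual_Suc[OF P] schur_step_form[OF positive_hermitian_residual[OF P]] Suc by simp
qed simp

lemma residual_expansion:
  "\<psi> - residual P e n \<psi> = (\<Sum>k<n. scaleC (cinner (P (residual P e k \<psi>)) (e k) /
     cinner (P (residual P e k (e k))) (e k)) (residual P e k (e k)))"
  by (induction n) (auto simp: algebra_simps)

text \<open>
  Let \<open>P\<close> be the absolute value of \<open>S\<close> and \<open>e\<close> an orthonormal basis on which \<open>P\<close> has finite
  trace. Cholesky elimination of \<open>P\<close> along \<open>e\<close> leaves \<open>P (R n \<psi>)\<close>, which vanishes on each basis
  vector after finitely many steps and is bounded uniformly in \<open>n\<close>, so it tends to zero for every
  \<open>\<psi>\<close>. Because \<open>norm (S \<psi>) = norm (P \<psi>)\<close>, also \<open>S (R n \<psi>)\<close> tends to zero. Thus \<open>S\<close> is the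
  sum of the rank-one operators split off on the way, and the sum of their norms is at most the trace of
  \<open>P\<close>.
\<close>

lemma trace_class_nuclear:
  fixes S :: "'a::euclidean_space l2 \<Rightarrow> 'a l2"
  assumes S: "trace_class S"
  shows "\<exists>a b :: nat \<Rightarrow> 'a l2. summable (\<lambda>n. norm (a n) * norm (b n)) \<and>
    (\<forall>\<psi> \<phi>. (\<lambda>n. cinner \<psi> (a n) * cinner (b n) \<phi>) sums cinner (S \<psi>) \<phi>)"
proof -
  obtain P E where SB: "bounded_op S" and P: "positive_op P" and PP: "P \<circ> P = adj S \<circ> S"
    and E: "is_onb E" and Esum: "(\<lambda>e. cinner (P e) e) summable_on E"
    using S unfolding trace_class_def by blast
  interpret S: bounded_linear S using SB by (simp add: bounded_op_def)
  have S_scale: "S (scaleC c \<psi>) = scaleC c (S \<psi>)" for c \<psi> using SB by (simp add: bounded_op_def)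
  interpret P: bounded_linear P using P by (simp add: positive_op_def bounded_op_def)
  note PH = positive_hermitian_positive_op[OF P]
  obtain e where e: "onb_seq e"
    and eE: "\<And>(g::'a l2 \<Rightarrow> complex) x. g 0 = 0 \<Longrightarrow> (g has_sum x) E \<longleftrightarrow> ((\<lambda>n. g (e n)) has_sum x) UNIV"
    using onb_enumeration[OF E] by metis
  obtain t where "((\<lambda>e. cinner (P e) e) has_sum t) E"
    using Esum unfolding summable_on_def by blast
  then have "((\<lambda>n. cinner (P (e n)) (e n)) has_sum t) UNIV"
    by (subst (asm) eE) (auto simp: P.zero)
  then have "(\<lambda>n. Re (cinner (P (e n)) (e n))) sums Re t"
    by (intro sums_Re has_sum_imp_sums)
  then have "summable (\<lambda>n. Re (cinner (P (e n)) (e n)))" "Re t = (\<Sum>n. Re (cinner (P (e n)) (e n)))"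
    by (auto simp: sums_iff)
  then have trP: "(\<Sum>j<J. Re (cinner (P (e j)) (e j))) \<le> Re t" for J
    by (auto intro!: sum_le_suminf positive_hermitianD(4)[OF PH])
  obtain K where K: "K > 0" and PK: "\<And>\<psi>. norm (P \<psi>) \<le> norm \<psi> * K" using P.pos_bounded by blast
  have form_le: "Re (cinner (P \<psi>) \<psi>) \<le> K * (norm \<psi>)\<^sup>2" for \<psi>
  proof -
    have "Re (cinner (P \<psi>) \<psi>) \<le> norm (P \<psi>) * norm \<psi>"
      by (rule order_trans[OF complex_Re_le_cmod cinner_Cauchy_Schwarz])
    also have "\<dots> \<le> norm \<psi> * K * norm \<psi>" by (intro mult_right_mono PK) simp
    finally show ?thesis by (simp add: power2_eq_square mult_ac)
  qed
  have SP: "norm (S \<psi>) = norm (P \<psi>)" for \<psi>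
  proof -
    have "cinner (S \<psi>) (S \<psi>) = cinner \<psi> (P (P \<psi>))"
      using cinner_adj[OF e SB, of \<psi> "S \<psi>"] fun_cong[OF PP, of \<psi>] by simp
    also have "\<dots> = cinner (P \<psi>) (P \<psi>)" by (simp add: positive_hermitianD(7)[OF PH])
    finally have "(norm (S \<psi>))\<^sup>2 = (norm (P \<psi>))\<^sup>2"
      by (simp only: cinner_self of_real_eq_iff)
    then show ?thesis by simp
  qed
  define R where "R = residual P e"
  define d where "d k = Re (cinner (P (R k (e k))) (e k))" for k
  have RH: "positive_hermitian (\<lambda>\<psi>. P (R n \<psi>))" for n
    unfolding R_def by (rule positive_hermitian_residual[OF PH])
  note RD = positive_hermitianD[OF RH]
  have d: "cinner (P (R k (e k))) (e k) = of_real (d k)" "d k \<ge> 0" for k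
    unfolding d_def by (rule RD)+
  have form_R: "Re (cinner (P (R n \<psi>)) \<psi>)
      = Re (cinner (P \<psi>) \<psi>) - (\<Sum>k<n. (cmod (cinner (P (R k \<psi>)) (e k)))\<^sup>2 / d k)" for n \<psi>
    unfolding R_def d_def by (rule residual_form[OF PH])
  have form_R_le: "Re (cinner (P (R n \<psi>)) \<psi>) \<le> Re (cinner (P \<psi>) \<psi>)" for n \<psi>
    unfolding form_R using d(2) by (simp add: sum_nonneg)
  have form_R_bound: "Re (cinner (P (R n \<psi>)) \<psi>) \<le> K * (norm \<psi>)\<^sup>2" for n \<psi>
    using form_R_le form_le by (rule order_trans)
  note PR_sq = norm_positive_hermitian[OF RH K form_R_bound]
  have PR_norm: "norm (P (R n \<psi>)) \<le> K * norm \<psi>" for n \<psi>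
  proof -
    have "(norm (P (R n \<psi>)))\<^sup>2 \<le> K * (K * (norm \<psi>)\<^sup>2)"
      using K by (intro order_trans[OF PR_sq] mult_left_mono form_R_bound) auto
    then have "(norm (P (R n \<psi>)))\<^sup>2 \<le> (K * norm \<psi>)\<^sup>2" by (simp add: power2_eq_square mult_ac)
    then show ?thesis using K by (simp add: power2_le_iff_abs_le)
  qed
  have PR_e: "P (R n (e j)) = 0" if "j < n" for n j
    using that
  proof (induction n)
    case (Suc n)
    have eq: "P (R (Suc n) (e j)) = P (R n (e j)) -
        scaleC (cinner (P (R n (e j))) (e n) / of_real (d n)) (P (R n (e n)))"
      unfolding R_def P_residual_Suc[OF PH] schur_step_def using d(1)[of n] by (simp add: R_def)
    show ?case
    proof (cases "j = n")
      case True
      show ?thesis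
      proof (cases "d n = 0")
        case dn: True
        then have "(norm (P (R n (e n))))\<^sup>2 \<le> 0" using PR_sq[of n "e n"] d(1)[of n] by simp
        then show ?thesis using eq True by simp
      next
        case False
        then show ?thesis using eq True d(1)[of n] by simp
      qed
    next
      case False
      then have "P (R n (e j)) = 0" using Suc by simp
      then show ?thesis using eq by simp
    qed
  qed simp
  have PR_lim: "(\<lambda>n. norm (P (R n \<psi>))) \<longlonglongrightarrow> 0" for \<psi>
  proof (rule LIMSEQ_I)
    fix \<epsilon> :: real assume \<epsilon>: "\<epsilon> > 0"
    define p where "p J = (\<Sum>j<J. scaleC (cinner \<psi> (e j)) (e j))" for J
    have "p \<longlonglongrightarrow> \<psi>" using onb_expansion[OF e, of \<psi>] unfolding p_def[abs_def] sums_def .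
    then obtain J where J: "norm (p J - \<psi>) < \<epsilon> / K"
      using LIMSEQ_D[of p \<psi> "\<epsilon> / K"] \<epsilon> K by auto
    have "norm (P (R n \<psi>)) < \<epsilon>" if n: "n \<ge> J" for n
    proof -
      have "P (R n 0) = 0" using RD(2)[of n 0 0] by simp
      then have "P (R n (p J)) = (\<Sum>j<J. P (R n (scaleC (cinner \<psi> (e j)) (e j))))" for J
        unfolding p_def by (induction J) (auto simp: RD(1))
      also have "(\<Sum>j<J. P (R n (scaleC (cinner \<psi> (e j)) (e j)))) = 0"
        using n by (intro sum.neutral) (auto simp: RD(2) PR_e)
      finally have "P (R n (p J)) = 0" .
      then have "norm (P (R n \<psi>)) = norm (P (R n (\<psi> - p J)))" by (simp add: RD(5))
      also have "\<dots> \<le> K * norm (\<psi> - p J)" by (rule PR_norm)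
      also have "\<dots> < \<epsilon>" using J K by (simp add: norm_minus_commute field_simps)
      finally show ?thesis .
    qed
    then show "\<exists>N. \<forall>n\<ge>N. norm (norm (P (R n \<psi>)) - 0) < \<epsilon>" by auto
  qed
  \<comment> \<open>The normalising factor of the \<open>k\<close>-th rank-one term is put entirely into \<open>b\<close>; if \<open>d k = 0\<close>
    the term vanishes because \<open>1 / 0 = 0\<close>.\<close>
  define a where "a k = P (R k (e k))" for k
  define b where "b k = scaleC (of_real (1 / d k)) (S (R k (e k)))" for k
  have ab: "norm (a k) * norm (b k) = (norm (a k))\<^sup>2 / d k" for k
    using d(2)[of k] by (simp add: b_def norm_scaleC SP a_def power2_eq_square norm_divide)
  \<comment> \<open>Expand \<open>a k\<close> in the basis and sum over \<open>k\<close> first: by the Bessel-type inequality for the form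
    of \<open>P\<close>, each basis vector \<open>e j\<close> contributes at most \<open>cinner (P (e j)) (e j)\<close>.\<close>
  have "(\<Sum>k<n. norm (a k) * norm (b k)) \<le> Re t" for n
  proof -
    have norm_a: "(\<lambda>j. (cmod (cinner (a k) (e j)))\<^sup>2) sums (norm (a k))\<^sup>2" for k
    proof -
      have "(\<lambda>j. complex_of_real ((cmod (cinner (a k) (e j)))\<^sup>2)) sums of_real ((norm (a k))\<^sup>2)"
        using Parseval_identity[OF e, of "a k" "a k"]
        by (simp only: complex_norm_square cinner_self cinner_commute[of "e _" "a k"])
      then show ?thesis by (simp only: sums_of_real_iff)
    qed
    have "(\<lambda>j. \<Sum>k<n. (cmod (cinner (a k) (e j)))\<^sup>2 / d k) sums (\<Sum>k<n. (norm (a k))\<^sup>2 / d k)"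
      by (intro sums_sum sums_divide norm_a)
    moreover have "(\<Sum>j<J. \<Sum>k<n. (cmod (cinner (a k) (e j)))\<^sup>2 / d k) \<le> Re t" for J
    proof -
      have "(\<Sum>k<n. (cmod (cinner (a k) (e j)))\<^sup>2 / d k) \<le> Re (cinner (P (e j)) (e j))" for j
      proof -
        have "cmod (cinner (a k) (e j)) = cmod (cinner (P (R k (e j))) (e k))" for k
          unfolding a_def by (subst RD(3)) simp
        then show ?thesis using form_R[of n "e j"] RD(4)[of n "e j"] by simp
      qed
      then have "(\<Sum>j<J. \<Sum>k<n. (cmod (cinner (a k) (e j)))\<^sup>2 / d k) \<le> (\<Sum>j<J. Re (cinner (P (e j)) (e j)))"
        by (rule sum_mono)
      also have "\<dots> \<le> Re t" by (rule trP)
      finally show ?thesis .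
    qed
    ultimately have "(\<Sum>k<n. (norm (a k))\<^sup>2 / d k) \<le> Re t"
      unfolding sums_def by (intro LIMSEQ_le_const2) auto
    then show ?thesis by (simp add: ab)
  qed
  then have "summable (\<lambda>n. norm (a n) * norm (b n))"
    by (intro bounded_imp_summable[where B = "Re t"]) (simp_all only: lessThan_Suc_atMost[symmetric] norm_ge_zero mult_nonneg_nonneg)
  moreover have "(\<lambda>n. cinner \<psi> (a n) * cinner (b n) \<phi>) sums cinner (S \<psi>) \<phi>" for \<psi> \<phi>
  proof -
    have "(\<Sum>k<n. cinner \<psi> (a k) * cinner (b k) \<phi>) = cinner (S \<psi>) \<phi> - cinner (S (R n \<psi>)) \<phi>" for n
    proof -
      have "S \<psi> - S (R n \<psi>) = S (\<psi> - R n \<psi>)" by (simp add: S.diff)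
      also have "\<dots> = (\<Sum>k<n. scaleC (cinner (P (R k \<psi>)) (e k) / of_real (d k)) (S (R k (e k))))"
        unfolding R_def residual_expansion S.sum S_scale d(1)[unfolded R_def] ..
      also have "cinner \<dots> \<phi> = (\<Sum>k<n. cinner \<psi> (a k) * cinner (b k) \<phi>)"
        unfolding cinner_sum_left cinner_scaleC_left a_def b_def
        by (intro sum.cong refl) (simp add: RD(7)[of _ \<psi>])
      finally show ?thesis by (simp add: cinner_diff_left)
    qed
    moreover have "(\<lambda>n. cinner (S \<psi>) \<phi> - cinner (S (R n \<psi>)) \<phi>) \<longlonglongrightarrow> cinner (S \<psi>) \<phi> - cinner 0 \<phi>"
      using PR_lim[of \<psi>]
      by (intro tendsto_diff tendsto_const tendsto_cinner[OF tendsto_norm_zero_cancel]) (simp add: SP)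
    ultimately show ?thesis by (simp add: sums_def)
  qed
  ultimately show ?thesis by blast
qed

section \<open>Traces of nuclear operators\<close>

text \<open>
  The point of the bound is its independence of the orthonormal family: conjugating the operator
  with a unitary only changes the family.
\<close>

lemma nuclear_diagonal_bound:
  fixes f :: "nat \<Rightarrow> 'a::euclidean_space l2"
  assumes f: "orthonormal_family UNIV f"
    and ab: "summable (\<lambda>n. norm (a n) * norm (b n))"
    and T: "\<And>\<psi> \<phi>. (\<lambda>n. cinner \<psi> (a n) * cinner (b n) \<phi>) sums cinner (T \<psi>) \<phi>"
  shows "(\<Sum>m<M. cmod (cinner (T (f m)) (f m))) \<le> (\<Sum>n. norm (a n) * norm (b n))"
proof -
  define x where "x n m = cinner (f m) (a n) * cinner (b n) (f m)" for n m
  have x_bound: "(\<Sum>m<M. cmod (x n m)) \<le> norm (a n) * norm (b n)" for n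
    using Bessel_product_bound[OF orthonormal_family_mono[OF f], of "{..<M}" "b n" "a n"]
    by (simp add: x_def norm_mult mult_ac)
  have "(\<Sum>m<M. cmod (\<Sum>n<N. x n m)) \<le> (\<Sum>n. norm (a n) * norm (b n))" for N
  proof -
    have "(\<Sum>m<M. cmod (\<Sum>n<N. x n m)) \<le> (\<Sum>m<M. \<Sum>n<N. cmod (x n m))"
      by (intro sum_mono norm_sum)
    also have "\<dots> = (\<Sum>n<N. \<Sum>m<M. cmod (x n m))" by (rule sum.swap)
    also have "\<dots> \<le> (\<Sum>n<N. norm (a n) * norm (b n))" by (intro sum_mono x_bound)
    also have "\<dots> \<le> (\<Sum>n. norm (a n) * norm (b n))" by (intro sum_le_suminf ab) auto
    finally show ?thesis .
  qed
  moreover have "(\<lambda>N. \<Sum>m<M. cmod (\<Sum>n<N. x n m)) \<longlonglongrightarrow> (\<Sum>m<M. cmod (cinner (T (f m)) (f m)))"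
    using T unfolding x_def sums_def by (intro tendsto_sum tendsto_norm)
  ultimately show ?thesis by (intro LIMSEQ_le_const2) auto
qed

text \<open>
  Parseval's identity evaluates the sum over the basis for each rank-one term, and the preceding
  domination allows the two sums to be interchanged (Tannery's theorem). The value is independent of
  the basis.
\<close>

lemma nuclear_diagonal_sums:
  fixes f :: "nat \<Rightarrow> 'a::euclidean_space l2"
  assumes f: "onb_seq f"
    and ab: "summable (\<lambda>n. norm (a n) * norm (b n))"
    and T: "\<And>\<psi> \<phi>. (\<lambda>n. cinner \<psi> (a n) * cinner (b n) \<phi>) sums cinner (T \<psi>) \<phi>"
  shows "(\<lambda>m. cinner (T (f m)) (f m)) sums (\<Sum>n. cinner (b n) (a n))"
proof -
  note on = onb_seq_orthonormal[OF f]
  define x where "x n m = cinner (b n) (f m) * cinner (f m) (a n)" for n m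
  have "(\<lambda>M. \<Sum>n. \<Sum>m<M. x n m) \<longlonglongrightarrow> (\<Sum>n. cinner (b n) (a n))"
  proof (rule tannerys_theorem[THEN conjunct2, THEN conjunct2])
    show "(\<lambda>M. \<Sum>m<M. x n m) \<longlonglongrightarrow> cinner (b n) (a n)" for n
      using Parseval_identity[OF f, of "b n" "a n"] unfolding x_def sums_def .
    have "norm (\<Sum>m<M. x n m) \<le> norm (a n) * norm (b n)" for n M
      using Bessel_product_bound[OF on, of "{..<M}" "b n" "a n"]
      by (intro order_trans[OF norm_sum]) (simp add: x_def norm_mult mult_ac)
    then show "\<forall>\<^sub>F (n, M) in sequentially \<times>\<^sub>F sequentially.
        norm (\<Sum>m<M. x n m) \<le> norm (a n) * norm (b n)"
      by (intro always_eventually) auto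
  qed (use ab in auto)
  moreover have "(\<Sum>n. \<Sum>m<M. x n m) = (\<Sum>m<M. cinner (T (f m)) (f m))" for M
  proof (intro sums_unique[symmetric] sums_sum)
    show "(\<lambda>n. x n m) sums cinner (T (f m)) (f m)" for m
      using T[of "f m" "f m"] by (simp add: x_def mult.commute)
  qed
  ultimately show ?thesis by (simp add: sums_def)
qed

text \<open>
  The trace is defined by an arbitrary fixed orthonormal basis; \<open>f\<close> enumerates that basis, so the same
  \<open>f\<close> computes the traces of all operators.
\<close>

lemma trace_eq_sums:
  assumes E: "is_onb (E :: 'a::euclidean_space l2 set)"
  shows "\<exists>f::nat \<Rightarrow> 'a l2. onb_seq f \<and> (\<forall>T t. summable (\<lambda>n. cmod (cinner (T (f n)) (f n))) \<and>
    (\<lambda>n. cinner (T (f n)) (f n)) sums t \<longrightarrow> trace T = t)"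
proof -
  have "is_onb (SOME E::'a l2 set. is_onb E)" using E by (rule someI)
  then obtain f where f: "onb_seq f"
    and F: "\<And>(g::'a l2 \<Rightarrow> complex) x. g 0 = 0 \<Longrightarrow>
      (g has_sum x) (SOME E. is_onb E) \<longleftrightarrow> ((\<lambda>n. g (f n)) has_sum x) UNIV"
    using onb_enumeration by metis
  have "trace T = t" if "summable (\<lambda>n. cmod (cinner (T (f n)) (f n)))"
    "(\<lambda>n. cinner (T (f n)) (f n)) sums t" for T t
    unfolding trace_def using norm_summable_imp_has_sum[OF that] F[of "\<lambda>\<psi>. cinner (T \<psi>) \<psi>"]
    by (intro infsumI) simp
  with f show ?thesis by blast
qed

section \<open>Time-frequency shifts\<close>

lemma square_integrable_tf_shift:
  assumes "square_integrable f"
  shows "square_integrable (\<lambda>t. exp (2 * complex_of_real pi * \<i> * complex_of_real (\<omega> \<bullet> t)) * f (t - x))"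
  using assms by (rule square_integrable_modulate_shift) auto

lemma tf_shift_abs_l2:
  assumes "square_integrable f"
  shows "tf_shift (x, \<omega>) (abs_l2 f)
       = abs_l2 (\<lambda>t. exp (2 * complex_of_real pi * \<i> * complex_of_real (\<omega> \<bullet> t)) * f (t - x))"
  using assms by (subst tf_shift.abs_eq) (auto simp: l2_rel_def)

lemma scaleC_abs_l2: "square_integrable f \<Longrightarrow> scaleC c (abs_l2 f) = abs_l2 (\<lambda>t. c * f t)"
  by (subst scaleC.abs_eq) (auto simp: l2_rel_def)

lemma cinner_abs_l2:
  "square_integrable f \<Longrightarrow> square_integrable g \<Longrightarrow>
    cinner (abs_l2 f) (abs_l2 g) = (\<integral>t. f t * cnj (g t) \<partial>lborel)"
  by (subst cinner.abs_eq) (auto simp: l2_rel_def)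

lemma tf_shift_scaleC: "tf_shift z (scaleC c \<psi>) = scaleC c (tf_shift z \<psi>)"
proof (cases z)
  case (Pair x \<omega>)
  obtain f where f: "square_integrable f" "\<psi> = abs_l2 f" using l2_representative by metis
  show ?thesis
    unfolding Pair f(2)
    by (simp add: tf_shift_abs_l2 scaleC_abs_l2 f square_integrable_cmult square_integrable_tf_shift mult.left_commute)
qed

lemma tf_shift_zero: "tf_shift (0, 0) \<psi> = \<psi>"
  by transfer (auto simp: l2_rel_def)

lemma tf_shift_compose:
  "tf_shift (x, \<omega>) (tf_shift (x', \<omega>') \<psi>)
   = scaleC (exp (- 2 * of_real pi * \<i> * of_real (\<omega>' \<bullet> x))) (tf_shift (x + x', \<omega> + \<omega>') \<psi>)"
proof -
  obtain f where f: "square_integrable f" "\<psi> = abs_l2 f" using l2_representative by metis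
  let ?m = "\<lambda>\<omega> t. exp (2 * complex_of_real pi * \<i> * complex_of_real (\<omega> \<bullet> t))"
  let ?c = "exp (- 2 * complex_of_real pi * \<i> * complex_of_real (\<omega>' \<bullet> x))"
  have m: "?m \<omega> t * ?m \<omega>' (t - x) = ?c * ?m (\<omega> + \<omega>') t" for t
    unfolding mult_exp_exp by (rule arg_cong[of _ _ exp]) (simp add: inner_simps algebra_simps)
  have "?m \<omega> t * (?m \<omega>' (t - x) * f (t - x - x')) = ?c * (?m (\<omega> + \<omega>') t * f (t - (x + x')))" for t
    unfolding mult.assoc[symmetric] m by (simp add: diff_diff_eq)
  then show ?thesis
    unfolding f(2)
    by (simp only: tf_shift_abs_l2 scaleC_abs_l2 f square_integrable_tf_shift)
qed

lemma cinner_tf_shift: "cinner (tf_shift z \<psi>) (tf_shift z \<phi>) = cinner \<psi> \<phi>"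
proof (cases z)
  case (Pair x \<omega>)
  obtain f g where fg: "square_integrable f" "\<psi> = abs_l2 f" "square_integrable g" "\<phi> = abs_l2 g"
    using l2_representative by metis
  let ?m = "\<lambda>t. exp (2 * complex_of_real pi * \<i> * complex_of_real (\<omega> \<bullet> t))"
  have "(\<integral>t. ?m t * f (t - x) * cnj (?m t * g (t - x)) \<partial>lborel)
      = (\<integral>t. f (- x + t) * cnj (g (- x + t)) \<partial>lborel)"
  proof (rule Bochner_Integration.integral_cong[OF refl])
    fix t
    have "?m t * cnj (?m t) = 1"
      unfolding complex_norm_square[symmetric] by simp
    then have "(?m t * cnj (?m t)) * (f (t - x) * cnj (g (t - x))) = f (t - x) * cnj (g (t - x))"
      by simp
    then show "?m t * f (t - x) * cnj (?m t * g (t - x)) = f (- x + t) * cnj (g (- x + t))"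
      by (simp only: complex_cnj_mult mult_ac) simp
  qed
  also have "\<dots> = (\<integral>t. f t * cnj (g t) \<partial>distr lborel borel ((+) (- x)))"
    using square_integrable_mult_cnj[OF fg(1,3), THEN borel_measurable_integrable]
    by (subst integral_distr) auto
  also have "\<dots> = (\<integral>t. f t * cnj (g t) \<partial>lborel)" by (subst lborel_distr_plus) simp
  finally show ?thesis
    unfolding Pair fg(2,4) by (simp add: tf_shift_abs_l2 cinner_abs_l2 fg square_integrable_tf_shift)
qed

lemma norm_tf_shift: "norm (tf_shift z \<psi>) = norm \<psi>"
  using cinner_tf_shift[of z \<psi> \<psi>] by (simp add: norm_l2_def inner_l2_def)

lemma adj_tf_shift:
  "adj (tf_shift (x, \<omega>)) =
     (\<lambda>\<phi>. scaleC (exp (- 2 * of_real pi * \<i> * of_real (\<omega> \<bullet> x))) (tf_shift (- x, - \<omega>) \<phi>))"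
    (is "_ = ?V")
proof (rule adj_eqI)
  fix \<psi> \<phi> :: "'a l2"
  have "tf_shift (x, \<omega>) (?V \<phi>) = \<phi>"
    by (simp add: tf_shift_scaleC tf_shift_compose scaleC_scaleC tf_shift_zero mult_exp_exp)
  then show "cinner (tf_shift (x, \<omega>) \<psi>) \<phi> = cinner \<psi> (?V \<phi>)"
    by (metis cinner_tf_shift)
qed

lemma tf_shift_adj [simp]: "tf_shift z (adj (tf_shift z) \<phi>) = \<phi>"
  by (cases z)
     (simp add: adj_tf_shift tf_shift_scaleC tf_shift_compose scaleC_scaleC tf_shift_zero mult_exp_exp)

lemma cinner_tf_shift_adj: "cinner (tf_shift z \<psi>) \<phi> = cinner \<psi> (adj (tf_shift z) \<phi>)"
  by (metis cinner_tf_shift tf_shift_adj)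

lemma cinner_adj_tf_shift: "cinner (adj (tf_shift z) \<psi>) \<phi> = cinner \<psi> (tf_shift z \<phi>)"
  by (metis cinner_tf_shift tf_shift_adj)

lemma norm_adj_tf_shift: "norm (adj (tf_shift z) \<psi>) = norm \<psi>"
  by (metis norm_tf_shift tf_shift_adj)

text \<open>
  The source of the symplectic form: it is the phase by which time-frequency shifts fail to commute.
\<close>

lemma tf_shift_commute:
  "tf_shift (- w) (tf_shift z \<psi>)
   = scaleC (exp (- 2 * of_real pi * \<i> * of_real (symplectic w z))) (tf_shift z (tf_shift (- w) \<psi>))"
proof (cases w, cases z)
  fix x \<omega> x' \<omega>' assume "w = (x, \<omega>)" "z = (x', \<omega>')"
  then show ?thesis
    by (simp add: tf_shift_compose scaleC_scaleC mult_exp_exp algebra_simps)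
qed

lemma onb_seq_adj_tf_shift:
  assumes f: "onb_seq f" shows "onb_seq (\<lambda>n. adj (tf_shift z) (f n))"
  unfolding onb_seq_def orthonormal_family_def
proof (intro conjI ballI allI impI)
  have on: "orthonormal_family UNIV f" using f by (simp add: onb_seq_def)
  show "cinner (adj (tf_shift z) (f i)) (adj (tf_shift z) (f j)) = 0" if "i \<noteq> j" for i j
    using on that by (simp add: cinner_adj_tf_shift orthonormal_family_def)
  show "adj (tf_shift z) (f i) = 0 \<or> norm (adj (tf_shift z) (f i)) = 1" for i
  proof (cases "f i = 0")
    case True
    then have "norm (adj (tf_shift z) (f i)) = 0" by (simp add: norm_adj_tf_shift)
    then show ?thesis by simp
  next
    case False
    then show ?thesis using on by (auto simp: norm_adj_tf_shift orthonormal_family_def)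
  qed
  fix \<psi> assume "\<forall>n. cinner \<psi> (adj (tf_shift z) (f n)) = 0"
  then have "tf_shift z \<psi> = 0"
    using f by (simp add: onb_seq_def cinner_tf_shift_adj)
  then show "\<psi> = 0" by (metis norm_tf_shift norm_eq_zero)
qed

text \<open>
  Measurability, as opposed to continuity, is immediate from Fubini's theorem because the integrand is
  jointly measurable in the phase space point and the integration variable.
\<close>

lemma measurable_cinner_tf_shift:
  fixes \<psi> \<phi> :: "'a::euclidean_space l2"
  shows "(\<lambda>z. cinner (tf_shift z \<psi>) \<phi>) \<in> borel_measurable borel"
proof -
  obtain f g where f: "square_integrable f" "\<psi> = abs_l2 f" and g: "square_integrable g" "\<phi> = abs_l2 g"
    using l2_representative by metis
  note [measurable] = square_integrable_measurable[OF f(1)] square_integrable_measurable[OF g(1)]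
  let ?h = "\<lambda>z t. exp (2 * complex_of_real pi * \<i> * complex_of_real (snd z \<bullet> t)) * f (t - fst z)"
  have "cinner (tf_shift z \<psi>) \<phi> = (\<integral>t. ?h z t * cnj (g t) \<partial>lborel)" for z
    unfolding f(2) g(2)
    by (cases z) (simp add: tf_shift_abs_l2 cinner_abs_l2 f g square_integrable_tf_shift)
  moreover have "(\<lambda>z. \<integral>t. ?h z t * cnj (g t) \<partial>lborel) \<in> borel_measurable (borel :: ('a \<times> 'a) measure)"
  proof (rule lborel.borel_measurable_lebesgue_integral)
    have [measurable]: "fst \<in> borel_measurable (borel :: ('a \<times> 'a) measure)"
      "snd \<in> borel_measurable (borel :: ('a \<times> 'a) measure)"
      by (auto intro!: borel_measurable_continuous_onI continuous_intros)
    have [measurable]: "cnj \<in> borel_measurable borel"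
      by (auto intro!: borel_measurable_continuous_onI continuous_intros)
    show "(\<lambda>(z, t). ?h z t * cnj (g t)) \<in> borel_measurable ((borel :: ('a \<times> 'a) measure) \<Otimes>\<^sub>M lborel)"
      by measurable
  qed
  ultimately show ?thesis by simp
qed

section \<open>Integration against a complex measure\<close>

lemma sets_pos_variation: "sets (pos_variation \<nu>) = sets borel"
  unfolding pos_variation_def
  using sets.sigma_sets_eq[of borel] by (simp add: sets_measure_of_conv)

text \<open>
  A set function that fails to be countably additive is replaced by zero in \<^const>\<open>measure_of\<close>;
  in either case the total mass is bounded by \<open>C\<close>.
\<close>

lemma finite_measure_pos_variation:
  assumes "\<And>A. A \<in> sets borel \<Longrightarrow> \<nu> A \<le> C"
  shows "finite_measure (pos_variation \<nu>)"
proof (rule finite_measureI)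
  have "emeasure (pos_variation \<nu>) UNIV \<le> (SUP B\<in>{B \<in> sets borel. B \<subseteq> UNIV}. ennreal (\<nu> B))"
    unfolding pos_variation_def emeasure_measure_of_conv by simp
  also have "\<dots> \<le> ennreal C"
    using assms by (intro SUP_least ennreal_leI) auto
  finally have "emeasure (pos_variation \<nu>) UNIV < \<infinity>"
    by (rule order.strict_trans1) simp
  moreover have "space (pos_variation \<nu>) = UNIV"
    by (simp add: pos_variation_def space_measure_of_conv)
  ultimately show "emeasure (pos_variation \<nu>) (space (pos_variation \<nu>)) \<noteq> \<infinity>" by simp
qed

text \<open>
  Integration against a complex measure is a combination of four integrals against finite measures,
  which is all that the limit theorems below require.
\<close>

lemma cm_integral_finite_measures:
  fixes \<mu> :: "'a::topological_space set \<Rightarrow> complex"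
  assumes "complex_measure \<mu>"
  shows "\<exists>M1 M2 M3 M4. (\<forall>M\<in>{M1, M2, M3, M4}. finite_measure M \<and> sets M = sets borel) \<and>
    (\<forall>f. cm_integral \<mu> f = (\<integral>z. f z \<partial>M1) - (\<integral>z. f z \<partial>M2) + \<i> * ((\<integral>z. f z \<partial>M3) - (\<integral>z. f z \<partial>M4)))"
proof -
  obtain C where C: "\<And>A. A \<in> sets borel \<Longrightarrow> cmod (\<mu> A) \<le> C"
    using assms unfolding complex_measure_def by blast
  have bd: "Re (\<mu> A) \<le> C" "- Re (\<mu> A) \<le> C" "Im (\<mu> A) \<le> C" "- Im (\<mu> A) \<le> C" if "A \<in> sets borel" for A
    using C[OF that] abs_Re_le_cmod[of "\<mu> A"] abs_Im_le_cmod[of "\<mu> A"] by linarith+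
  have "\<forall>f. cm_integral \<mu> f =
      (\<integral>z. f z \<partial>pos_variation (\<lambda>A. Re (\<mu> A))) - (\<integral>z. f z \<partial>pos_variation (\<lambda>A. - Re (\<mu> A)))
      + \<i> * ((\<integral>z. f z \<partial>pos_variation (\<lambda>A. Im (\<mu> A))) - (\<integral>z. f z \<partial>pos_variation (\<lambda>A. - Im (\<mu> A))))"
    by (simp add: cm_integral_def signed_integral_def)
  moreover have "\<forall>M\<in>{pos_variation (\<lambda>A. Re (\<mu> A)), pos_variation (\<lambda>A. - Re (\<mu> A)),
      pos_variation (\<lambda>A. Im (\<mu> A)), pos_variation (\<lambda>A. - Im (\<mu> A))}.
      finite_measure M \<and> sets M = sets borel"
    using bd by (auto simp: sets_pos_variation intro!: finite_measure_pos_variation)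
  ultimately show ?thesis by (intro exI conjI)
qed

lemma finite_measure_integrable_bounded:
  fixes f :: "'a::topological_space \<Rightarrow> complex"
  assumes M: "finite_measure M" "sets M = sets borel"
    and f: "f \<in> borel_measurable borel" "\<And>z. cmod (f z) \<le> B"
  shows "integrable M f"
  using f M(2)
  by (intro finite_measure.integrable_const_bound[OF M(1), of _ B]) (auto cong: measurable_cong_sets)

lemma cm_integral_add:
  assumes \<mu>: "complex_measure \<mu>"
    and f: "f \<in> borel_measurable borel" "\<And>z. cmod (f z) \<le> B"
    and g: "g \<in> borel_measurable borel" "\<And>z. cmod (g z) \<le> B'"
  shows "cm_integral \<mu> (\<lambda>z. f z + g z) = cm_integral \<mu> f + cm_integral \<mu> g"
proof -
  obtain M1 M2 M3 M4 where M: "\<And>M. M \<in> {M1, M2, M3, M4} \<Longrightarrow> finite_measure M \<and> sets M = sets borel"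
    and eq: "\<And>f. cm_integral \<mu> f = (\<integral>z. f z \<partial>M1) - (\<integral>z. f z \<partial>M2) + \<i> * ((\<integral>z. f z \<partial>M3) - (\<integral>z. f z \<partial>M4))"
    using cm_integral_finite_measures[OF \<mu>] by blast
  have "(\<integral>z. f z + g z \<partial>M) = (\<integral>z. f z \<partial>M) + (\<integral>z. g z \<partial>M)" if "M \<in> {M1, M2, M3, M4}" for M
    using M[OF that] finite_measure_integrable_bounded[OF _ _ f] finite_measure_integrable_bounded[OF _ _ g]
    by (intro Bochner_Integration.integral_add) auto
  then show ?thesis unfolding eq by (simp add: algebra_simps)
qed

lemma cm_integral_cmult: "cm_integral \<mu> (\<lambda>z. c * f z) = c * cm_integral \<mu> f"
  by (simp add: cm_integral_def signed_integral_def algebra_simps)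

lemma cm_integral_bound:
  fixes \<mu> :: "'a::topological_space set \<Rightarrow> complex"
  assumes \<mu>: "complex_measure \<mu>"
  shows "\<exists>C. \<forall>f B. f \<in> borel_measurable borel \<and> (\<forall>z. cmod (f z) \<le> B) \<longrightarrow> cmod (cm_integral \<mu> f) \<le> C * B"
proof -
  obtain M1 M2 M3 M4 where M: "\<And>M. M \<in> {M1, M2, M3, M4} \<Longrightarrow> finite_measure M \<and> sets M = sets borel"
    and eq: "\<And>f. cm_integral \<mu> f = (\<integral>z. f z \<partial>M1) - (\<integral>z. f z \<partial>M2) + \<i> * ((\<integral>z. f z \<partial>M3) - (\<integral>z. f z \<partial>M4))"
    using cm_integral_finite_measures[OF \<mu>] by blast
  let ?m = "\<lambda>M::'a measure. measure M (space M)"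
  have bound: "cmod (cm_integral \<mu> f) \<le> (?m M1 + ?m M2 + ?m M3 + ?m M4) * B"
    if f: "f \<in> borel_measurable borel" "\<And>z. cmod (f z) \<le> B" for f B
  proof -
    have int: "cmod (\<integral>z. f z \<partial>M) \<le> ?m M * B" if "M \<in> {M1, M2, M3, M4}" for M
    proof -
      interpret finite_measure M using M[OF that] by blast
      have i: "integrable M f"
        using M[OF that] f by (intro finite_measure_integrable_bounded) auto
      have "cmod (\<integral>z. f z \<partial>M) \<le> (\<integral>z. cmod (f z) \<partial>M)" by (rule integral_norm_bound)
      also have "\<dots> \<le> (\<integral>z. B \<partial>M)" using i f(2) by (intro integral_mono) auto
      finally show ?thesis by simp
    qed
    have "cmod (cm_integral \<mu> f) \<le> (cmod (\<integral>z. f z \<partial>M1) + cmod (\<integral>z. f z \<partial>M2))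
        + (cmod (\<integral>z. f z \<partial>M3) + cmod (\<integral>z. f z \<partial>M4))"
      unfolding eq
      by (intro order_trans[OF norm_triangle_ineq] add_mono norm_triangle_ineq4)
         (simp add: norm_mult norm_triangle_ineq4)
    also have "\<dots> \<le> (?m M1 * B + ?m M2 * B) + (?m M3 * B + ?m M4 * B)"
      by (intro add_mono int) auto
    finally show ?thesis by (simp add: algebra_simps)
  qed
  then show ?thesis by blast
qed

lemma finite_measure_integral_sums:
  fixes h :: "nat \<Rightarrow> 'a::topological_space \<Rightarrow> complex"
  assumes M: "finite_measure M" "sets M = sets borel"
    and h: "\<And>m. h m \<in> borel_measurable borel"
    and bound: "\<And>N z. (\<Sum>m<N. cmod (h m z)) \<le> K"
    and sums: "\<And>z. (\<lambda>m. h m z) sums H z"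
  shows "summable (\<lambda>m. cmod (\<integral>z. h m z \<partial>M))" "(\<lambda>m. \<integral>z. h m z \<partial>M) sums (\<integral>z. H z \<partial>M)"
proof -
  interpret finite_measure M by (rule M)
  have hM [measurable]: "h m \<in> borel_measurable M" for m
    using h[of m] M(2) by (simp cong: measurable_cong_sets)
  have "cmod (h m z) \<le> (\<Sum>k<Suc m. cmod (h k z))" for m z
    by (intro member_le_sum) auto
  then have hK: "cmod (h m z) \<le> K" for m z using bound order_trans by blast
  have int: "integrable M (h m)" for m
    by (rule finite_measure_integrable_bounded[OF M h hK])
  have "(\<Sum>m<N. cmod (\<integral>z. h m z \<partial>M)) \<le> measure M (space M) * K" for N
  proof -
    have "(\<Sum>m<N. cmod (\<integral>z. h m z \<partial>M)) \<le> (\<Sum>m<N. \<integral>z. cmod (h m z) \<partial>M)"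
      by (intro sum_mono integral_norm_bound)
    also have "\<dots> = (\<integral>z. (\<Sum>m<N. cmod (h m z)) \<partial>M)"
      using int by (intro Bochner_Integration.integral_sum[symmetric]) auto
    also have "\<dots> \<le> (\<integral>z. K \<partial>M)"
      using int bound by (intro integral_mono) auto
    finally show ?thesis by simp
  qed
  then show "summable (\<lambda>m. cmod (\<integral>z. h m z \<partial>M))"
    by (intro bounded_imp_summable[where B = "measure M (space M) * K"])
       (simp_all only: lessThan_Suc_atMost[symmetric] norm_ge_zero)
  have HM: "H \<in> borel_measurable M"
  proof (rule borel_measurable_LIMSEQ_metric)
    show "(\<lambda>N. \<Sum>m<N. h m z) \<longlonglongrightarrow> H z" for z using sums[of z] by (simp add: sums_def)
  qed measurable
  have "(\<lambda>N. \<integral>z. (\<Sum>m<N. h m z) \<partial>M) \<longlonglongrightarrow> (\<integral>z. H z \<partial>M)"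
  proof (rule integral_dominated_convergence[where w = "\<lambda>_. K"])
    show "AE z in M. (\<lambda>N. \<Sum>m<N. h m z) \<longlonglongrightarrow> H z"
      using sums by (simp add: sums_def)
    show "AE z in M. norm (\<Sum>m<N. h m z) \<le> K" for N
      using order_trans[OF norm_sum bound] by (intro AE_I2)
  qed (use HM in auto)
  then show "(\<lambda>m. \<integral>z. h m z \<partial>M) sums (\<integral>z. H z \<partial>M)"
    using int by (simp add: sums_def Bochner_Integration.integral_sum)
qed

text \<open>
  Both conclusions are needed: absolute summability makes the sequential sum agree with the unordered
  sum in the definition of the trace.
\<close>

lemma cm_integral_sums:
  fixes h :: "nat \<Rightarrow> 'a::topological_space \<Rightarrow> complex"
  assumes \<mu>: "complex_measure \<mu>"
    and h: "\<And>m. h m \<in> borel_measurable borel"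
    and bound: "\<And>N z. (\<Sum>m<N. cmod (h m z)) \<le> K"
    and sums: "\<And>z. (\<lambda>m. h m z) sums H z"
  shows "summable (\<lambda>m. cmod (cm_integral \<mu> (h m)))" "(\<lambda>m. cm_integral \<mu> (h m)) sums cm_integral \<mu> H"
proof -
  obtain M1 M2 M3 M4 where M: "\<And>M. M \<in> {M1, M2, M3, M4} \<Longrightarrow> finite_measure M \<and> sets M = sets borel"
    and eq: "\<And>f. cm_integral \<mu> f = (\<integral>z. f z \<partial>M1) - (\<integral>z. f z \<partial>M2) + \<i> * ((\<integral>z. f z \<partial>M3) - (\<integral>z. f z \<partial>M4))"
    using cm_integral_finite_measures[OF \<mu>] by blast
  have S: "summable (\<lambda>m. cmod (\<integral>z. h m z \<partial>M))" "(\<lambda>m. \<integral>z. h m z \<partial>M) sums (\<integral>z. H z \<partial>M)"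
    if "M \<in> {M1, M2, M3, M4}" for M
    using M[OF that] finite_measure_integral_sums[OF _ _ h bound sums] by auto
  show "(\<lambda>m. cm_integral \<mu> (h m)) sums cm_integral \<mu> H"
    unfolding eq by (intro sums_add sums_diff sums_mult S) auto
  have le: "cmod (cm_integral \<mu> (h m)) \<le> (cmod (\<integral>z. h m z \<partial>M1) + cmod (\<integral>z. h m z \<partial>M2))
      + (cmod (\<integral>z. h m z \<partial>M3) + cmod (\<integral>z. h m z \<partial>M4))" for m
    unfolding eq
    by (intro order_trans[OF norm_triangle_ineq] add_mono norm_triangle_ineq4)
       (simp add: norm_mult norm_triangle_ineq4)
  have "summable (\<lambda>m. (cmod (\<integral>z. h m z \<partial>M1) + cmod (\<integral>z. h m z \<partial>M2))
      + (cmod (\<integral>z. h m z \<partial>M3) + cmod (\<integral>z. h m z \<partial>M4)))"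
    by (intro summable_add S) auto
  then show "summable (\<lambda>m. cmod (cm_integral \<mu> (h m)))"
  proof (rule summable_comparison_test')
    show "norm (cmod (cm_integral \<mu> (h m))) \<le> (cmod (\<integral>z. h m z \<partial>M1) + cmod (\<integral>z. h m z \<partial>M2))
      + (cmod (\<integral>z. h m z \<partial>M3) + cmod (\<integral>z. h m z \<partial>M4))" for m
      using le[of m] by (simp only: real_norm_def abs_norm_cancel)
  qed
qed

section \<open>The convolution of a measure with an operator\<close>

text \<open>
  Conjugation by a time-frequency shift translates both sequences of vectors; the translates depend
  measurably on \<open>z\<close>, which yields the measurability of the integrand defining the convolution.
\<close>

lemma nuclear_conjugate:
  assumes T: "\<And>\<psi> \<phi>. (\<lambda>n. cinner \<psi> (a n) * cinner (b n) \<phi>) sums cinner (S \<psi>) \<phi>"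
  shows "(\<lambda>n. cinner \<psi> (tf_shift z (a n)) * cinner (tf_shift z (b n)) \<phi>)
    sums cinner (tf_shift z (S (adj (tf_shift z) \<psi>))) \<phi>"
  using T[of "adj (tf_shift z) \<psi>" "adj (tf_shift z) \<phi>"]
  by (simp add: cinner_adj_tf_shift cinner_tf_shift_adj)

lemma measurable_conjugate:
  assumes T: "\<And>\<psi> \<phi>. (\<lambda>n. cinner \<psi> (a n) * cinner (b n) \<phi>) sums cinner (S \<psi>) \<phi>"
  shows "(\<lambda>z. cinner (tf_shift z (S (adj (tf_shift z) \<psi>))) \<phi>) \<in> borel_measurable borel"
proof (rule borel_measurable_LIMSEQ_metric)
  show "(\<lambda>N. \<Sum>n<N. cinner \<psi> (tf_shift z (a n)) * cinner (tf_shift z (b n)) \<phi>)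
      \<longlonglongrightarrow> cinner (tf_shift z (S (adj (tf_shift z) \<psi>))) \<phi>" for z
    using nuclear_conjugate[OF T] by (simp add: sums_def)
  have [measurable]: "cnj \<in> borel_measurable borel"
    by (auto intro!: borel_measurable_continuous_onI continuous_intros)
  note [measurable] = measurable_cinner_tf_shift
  have eq: "cinner \<psi> (tf_shift z (a n)) = cnj (cinner (tf_shift z (a n)) \<psi>)" for z n
    by (rule cinner_commute)
  show "(\<lambda>z. \<Sum>n<N. cinner \<psi> (tf_shift z (a n)) * cinner (tf_shift z (b n)) \<phi>) \<in> borel_measurable borel" for N
    unfolding eq by measurable
qed

text \<open>
  The weak integral is a bounded sesquilinear form, so Riesz representation produces an operator
  satisfying the defining equation, and nondegeneracy makes it unique.
\<close>

lemma cinner_measure_conv: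
  fixes S :: "'a::euclidean_space l2 \<Rightarrow> 'a l2"
  assumes \<mu>: "complex_measure \<mu>" and S: "bounded_op S" and e: "onb_seq (e :: nat \<Rightarrow> 'a l2)"
    and T: "\<And>\<psi> \<phi>. (\<lambda>n. cinner \<psi> (a n) * cinner (b n) \<phi>) sums cinner (S \<psi>) \<phi>"
  shows "cinner ((\<mu> \<star> S) \<psi>) \<phi> = cm_integral \<mu> (\<lambda>z. cinner (tf_shift z (S (adj (tf_shift z) \<psi>))) \<phi>)"
proof -
  interpret S: bounded_linear S using S by (simp add: bounded_op_def)
  obtain K where K: "\<And>\<psi>. norm (S \<psi>) \<le> norm \<psi> * K" using S.bounded by blast
  define h where "h \<psi> \<phi> z = cinner (tf_shift z (S (adj (tf_shift z) \<psi>))) \<phi>" for \<psi> \<phi> z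
  have hm: "h \<psi> \<phi> \<in> borel_measurable borel" for \<psi> \<phi>
    unfolding h_def using T by (rule measurable_conjugate)
  have hb: "cmod (h \<psi> \<phi> z) \<le> norm \<psi> * K * norm \<phi>" for \<psi> \<phi> z
    unfolding h_def
    using K[of "adj (tf_shift z) \<psi>"]
    by (intro order_trans[OF cinner_Cauchy_Schwarz] mult_right_mono)
       (simp_all add: norm_tf_shift norm_adj_tf_shift)
  obtain C where C: "\<And>f B. f \<in> borel_measurable borel \<Longrightarrow> (\<And>z. cmod (f z) \<le> B) \<Longrightarrow> cmod (cm_integral \<mu> f) \<le> C * B"
    using cm_integral_bound[OF \<mu>] by blast
  have "\<exists>v. \<forall>\<phi>. cnj (cm_integral \<mu> (h \<psi> \<phi>)) = cinner \<phi> v" for \<psi>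
  proof (rule Riesz_representation[OF e])
    fix \<phi> \<phi>' c
    have "h \<psi> (\<phi> + \<phi>') = (\<lambda>z. h \<psi> \<phi> z + h \<psi> \<phi>' z)" by (simp add: h_def fun_eq_iff cinner_add_right)
    then show "cnj (cm_integral \<mu> (h \<psi> (\<phi> + \<phi>'))) = cnj (cm_integral \<mu> (h \<psi> \<phi>)) + cnj (cm_integral \<mu> (h \<psi> \<phi>'))"
      by (simp add: cm_integral_add[OF \<mu> hm hb hm hb])
    have "h \<psi> (scaleC c \<phi>) = (\<lambda>z. cnj c * h \<psi> \<phi> z)" by (simp add: h_def fun_eq_iff cinner_scaleC_right)
    then show "cnj (cm_integral \<mu> (h \<psi> (scaleC c \<phi>))) = c * cnj (cm_integral \<mu> (h \<psi> \<phi>))"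
      by (simp add: cm_integral_cmult)
    show "cmod (cnj (cm_integral \<mu> (h \<psi> \<phi>))) \<le> (C * (norm \<psi> * K)) * norm \<phi>"
      using C[OF hm[of \<psi> \<phi>] hb[of \<psi> \<phi>]] by (simp add: mult_ac)
  qed
  then obtain R where R: "\<And>\<psi> \<phi>. cnj (cm_integral \<mu> (h \<psi> \<phi>)) = cinner \<phi> (R \<psi>)" by metis
  have R': "cinner (R \<psi>) \<phi> = cm_integral \<mu> (h \<psi> \<phi>)" for \<psi> \<phi>
    using R[of \<psi> \<phi>] cinner_commute[of "R \<psi>" \<phi>] by (metis complex_cnj_cnj)
  have "\<mu> \<star> S = R"
    unfolding measure_conv_def h_def[symmetric, abs_def]
  proof (rule the_equality)
    show "\<forall>\<psi> \<phi>. cinner (R \<psi>) \<phi> = cm_integral \<mu> (h \<psi> \<phi>)" using R' by blast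
    fix R2 assume R2: "\<forall>\<psi> \<phi>. cinner (R2 \<psi>) \<phi> = cm_integral \<mu> (h \<psi> \<phi>)"
    show "R2 = R" by (rule ext, rule cinner_ext_left) (simp add: R2 R')
  qed
  then show ?thesis using R' unfolding h_def by simp
qed

theorem proposition3p7:
  fixes \<mu> :: "((real^'d) \<times> (real^'d)) set \<Rightarrow> complex"
    and S :: "(real^'d) l2 \<Rightarrow> (real^'d) l2"
  assumes "complex_measure \<mu>"
    and "trace_class S"
  shows "fourier_wigner (\<mu> \<star> S) = (\<lambda>z. symplectic_fourier \<mu> z * fourier_wigner S z)"
proof -
  obtain a b where ab: "summable (\<lambda>n. norm (a n) * norm (b n))"
    and Sab: "\<And>\<psi> \<phi>. (\<lambda>n. cinner \<psi> (a n) * cinner (b n) \<phi>) sums cinner (S \<psi>) \<phi>"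
    using trace_class_nuclear[OF assms(2)] by blast
  obtain E :: "(real^'d) l2 set" where S: "bounded_op S" and E: "is_onb E"
    using assms(2) unfolding trace_class_def by blast
  obtain f :: "nat \<Rightarrow> (real^'d) l2" where f: "onb_seq f"
    and trace: "\<And>T t. summable (\<lambda>n. cmod (cinner (T (f n)) (f n))) \<Longrightarrow>
      (\<lambda>n. cinner (T (f n)) (f n)) sums t \<Longrightarrow> trace T = t"
    using trace_eq_sums[OF E] by metis
  have key: "trace (tf_shift (- w) \<circ> (\<mu> \<star> S)) = symplectic_fourier \<mu> w * trace (tf_shift (- w) \<circ> S)" for w
  proof -
    define A where "A = tf_shift (- w)"
    \<comment> \<open>the character whose integral is the symplectic Fourier transform of \<open>\<mu>\<close> at \<open>w\<close>\<close>
    define \<gamma> where "\<gamma> z = exp (- 2 * complex_of_real pi * \<i> * of_real (symplectic w z))" for z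
    define \<tau> where "\<tau> = (\<Sum>n. cinner (A (b n)) (a n))"
    define K where "K = (\<Sum>n. norm (a n) * norm (A (b n)))"
    have ab': "summable (\<lambda>n. norm (a n) * norm (A (b n)))"
      using ab by (simp add: A_def norm_tf_shift)
    have ASab: "(\<lambda>n. cinner \<psi> (a n) * cinner (A (b n)) \<phi>) sums cinner ((A \<circ> S) \<psi>) \<phi>" for \<psi> \<phi>
      using Sab[of \<psi> "adj A \<phi>"] by (simp add: A_def cinner_tf_shift_adj)
    note diag_bound = nuclear_diagonal_bound[OF onb_seq_orthonormal ab' ASab, folded K_def]
    note diag_sums = nuclear_diagonal_sums[OF _ ab' ASab, folded \<tau>_def]
    have "summable (\<lambda>n. cmod (cinner ((A \<circ> S) (f n)) (f n)))"
      by (rule bounded_imp_summable[where B = K])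
         (simp_all only: lessThan_Suc_atMost[symmetric] norm_ge_zero diag_bound[OF f])
    then have trAS: "trace (A \<circ> S) = \<tau>" using diag_sums[OF f] by (rule trace)
    define h where "h m z = cinner (tf_shift z (S (adj (tf_shift z) (f m)))) (adj A (f m))" for m z
    \<comment> \<open>Move \<open>A\<close> past the shift by \<open>z\<close>, at the price of the phase \<open>\<gamma> z\<close>, and the shift to the
      other side: what remains are diagonal entries of \<open>A \<circ> S\<close> in a rotated basis.\<close>
    have h_eq: "h m z = \<gamma> z * cinner ((A \<circ> S) (adj (tf_shift z) (f m))) (adj (tf_shift z) (f m))" for m z
      unfolding h_def A_def cinner_tf_shift_adj[symmetric]
      by (simp add: tf_shift_commute cinner_scaleC_left \<gamma>_def cinner_tf_shift_adj)
    have \<gamma>1: "cmod (\<gamma> z) = 1" for z by (simp add: \<gamma>_def)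
    have h_meas: "h m \<in> borel_measurable borel" for m
      unfolding h_def using Sab by (rule measurable_conjugate)
    have h_bound: "(\<Sum>m<N. cmod (h m z)) \<le> K" for N z
      unfolding h_eq norm_mult \<gamma>1 using diag_bound[OF onb_seq_adj_tf_shift[OF f]] by simp
    have h_sums: "(\<lambda>m. h m z) sums (\<gamma> z * \<tau>)" for z
      unfolding h_eq by (intro sums_mult diag_sums onb_seq_adj_tf_shift f)
    have conv: "cinner ((A \<circ> (\<mu> \<star> S)) (f m)) (f m) = cm_integral \<mu> (h m)" for m
      unfolding h_def[abs_def]
      by (simp add: A_def cinner_tf_shift_adj cinner_measure_conv[OF assms(1) S f Sab])
    have "trace (A \<circ> (\<mu> \<star> S)) = cm_integral \<mu> (\<lambda>z. \<gamma> z * \<tau>)"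
      using cm_integral_sums[OF assms(1) h_meas h_bound h_sums]
      unfolding conv[symmetric] by (rule trace)
    also have "\<dots> = \<tau> * cm_integral \<mu> \<gamma>"
      unfolding cm_integral_cmult[symmetric] by (simp add: mult.commute)
    finally show ?thesis
      using trAS by (simp add: symplectic_fourier_def \<gamma>_def[abs_def] A_def mult.commute)
  qed
  show ?thesis
  proof
    fix w :: "(real^'d) \<times> (real^'d)"
    show "fourier_wigner (\<mu> \<star> S) w = symplectic_fourier \<mu> w * fourier_wigner S w"
      by (cases w) (simp add: fourier_wigner_def key mult.left_commute del: uminus_Pair)
  qed
qed

end
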